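(* Let $D$ be a dendron. For every topological group $G$ and every continuous action $G\curvearrowright D$, the dynamical $G$-system $D$ is Rosenthal representable, hence also tame.
   Context: A continuum is a compact connected Hausdorff space. A continuum $D$ is a dendron if every pair of distinct points $u,v\in D$ can be separated by a third point $w$, i.e. $D\setminus\{w\}=U\cup V$ with $U,V$ disjoint open, $u\in U$, $v\in V$. For a Banach space $V$, $Is(V)$ is the topological group of all linear isometries of $V$ onto $V$ with the strong operator topology. $V$ is a Rosenthal Banach space if it contains no isomorphic copy of $\ell_1$. A representation of an action $G\curvearrowright X$ on $V$ is a pair $(h,\alpha)$ where $h:G\to Is(V)$ is a strongly continuous co-homomorphism ($h(g_1g_2)=h(g_2)h(g_1)$), and $\alpha:X\to V^*$ is a weak-star continuous bounded map with $\langle v,\alpha(gx)\rangle=\langle h(g)(v),\alpha(x)\rangle$ for all $v\in V$, $g\in G$, $x\in X$. The $G$-system $X$ is Rosenthal representable if there are a Rosenthal Banach space $V$ and a representation $(h,\alpha)$ on $V$ such that $\alpha$ is a topological embedding (for the weak-star topology). Tame: a sequence $(f_n)_{n\in\mathbb{N}}$ of real-valued functions on a set $X$ is independent if there are real numbers $a<b$ such that $\bigcap_{n\in P}f_n^{-1}(-\infty,a)\cap\bigcap_{n\in M}f_n^{-1}(b,\infty)\neq\emptyset$ for all finite disjoint $P,M\subset\mathbb{N}$. A compact $G$-system $X$ is tame if for every continuous $f:X\to\mathbb{R}$ the family $fG=\{fg: g\in G\}$, where $(fg)(x)=f(gx)$, contains no independent sequence. *)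

theory Defs
  imports
    "HOL-Analysis.Analysis"
    "HOL-Algebra.Module"
    "HOL-Algebra.Group_Action"
    "HOL-Algebra.Algebraic_Closure_Type"
begin

section \<open>Dendrons\<close>

definition continuum :: "'a topology \<Rightarrow> bool" where
  "continuum D \<longleftrightarrow> compact_space D \<and> connected_space D \<and> Hausdorff_space D"

definition dendron :: "'a topology \<Rightarrow> bool" where
  "dendron D \<longleftrightarrow> continuum D \<and>
    (\<forall>u\<in>topspace D. \<forall>v\<in>topspace D. u \<noteq> v \<longrightarrow>
      (\<exists>w\<in>topspace D. \<exists>U V. openin D U \<and> openin D V \<and> U \<inter> V = {} \<and>
         topspace D - {w} = U \<union> V \<and> u \<in> U \<and> v \<in> V))"


section \<open>Topological groups and continuous actions\<close>

definition topological_group :: "('g, 'm) monoid_scheme \<Rightarrow> 'g topology \<Rightarrow> bool" where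
  "topological_group G T \<longleftrightarrow> group G \<and> topspace T = carrier G \<and>
     continuous_map (prod_topology T T) T (\<lambda>(g, h). g \<otimes>\<^bsub>G\<^esub> h) \<and>
     continuous_map T T (\<lambda>g. inv\<^bsub>G\<^esub> g)"

definition continuous_action ::
    "('g, 'm) monoid_scheme \<Rightarrow> 'g topology \<Rightarrow> 'a topology \<Rightarrow> ('g \<Rightarrow> 'a \<Rightarrow> 'a) \<Rightarrow> bool" where
  "continuous_action G T Y \<phi> \<longleftrightarrow> group_action G (topspace Y) \<phi> \<and>
     continuous_map (prod_topology T Y) Y (\<lambda>(g, x). \<phi> g x)"


section \<open>Real Banach spaces with an explicit carrier\<close>

text \<open>
  The theorem asserts the existence of a Banach space, so Banach spaces have to be values and not
  types of class \<^class>\<open>banach\<close>. They are modules over the field of real numbers with a norm;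
  the fields \<^term>\<open>monoid.mult\<close> and \<^term>\<open>monoid.one\<close> inherited from the ring record carry
  no meaning.
\<close>

record 'v normed_module = "(real, 'v) module" +
  vnorm :: "'v \<Rightarrow> real"

text \<open>
  The locale \<^locale>\<open>Metric_space\<close> wants nonnegativity and symmetry also outside the carrier,
  hence the default value.
\<close>

definition vdist :: "('v, 'n) normed_module_scheme \<Rightarrow> 'v \<Rightarrow> 'v \<Rightarrow> real" where
  "vdist V u v = (if u \<in> carrier V \<and> v \<in> carrier V then vnorm V (u \<ominus>\<^bsub>V\<^esub> v) else 0)"

definition norm_topology :: "('v, 'n) normed_module_scheme \<Rightarrow> 'v topology" where
  "norm_topology V = Metric_space.mtopology (carrier V) (vdist V)"

locale Normed_space = module "ring_of_type_algebra :: real ring" V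
  for V :: "('v, 'n) normed_module_scheme" (structure) +
  assumes vnorm_nonneg: "v \<in> carrier V \<Longrightarrow> 0 \<le> vnorm V v"
    and vnorm_eq_0_iff: "v \<in> carrier V \<Longrightarrow> vnorm V v = 0 \<longleftrightarrow> v = \<zero>\<^bsub>V\<^esub>"
    and vnorm_smult: "v \<in> carrier V \<Longrightarrow> vnorm V (c \<odot>\<^bsub>V\<^esub> v) = \<bar>c\<bar> * vnorm V v"
    and vnorm_triangle:
      "\<lbrakk>u \<in> carrier V; v \<in> carrier V\<rbrakk> \<Longrightarrow> vnorm V (u \<oplus>\<^bsub>V\<^esub> v) \<le> vnorm V u + vnorm V v"

locale Banach_space = Normed_space +
  assumes complete: "Metric_space.mcomplete (carrier V) (vdist V)"

definition linear_between ::
    "('v, 'n) normed_module_scheme \<Rightarrow> ('w, 'k) normed_module_scheme \<Rightarrow> ('v \<Rightarrow> 'w) \<Rightarrow> bool" where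
  "linear_between V W L \<longleftrightarrow> L \<in> carrier V \<rightarrow> carrier W \<and>
     (\<forall>u\<in>carrier V. \<forall>v\<in>carrier V. L (u \<oplus>\<^bsub>V\<^esub> v) = L u \<oplus>\<^bsub>W\<^esub> L v) \<and>
     (\<forall>c. \<forall>v\<in>carrier V. L (c \<odot>\<^bsub>V\<^esub> v) = c \<odot>\<^bsub>W\<^esub> L v)"


subsection \<open>Rosenthal Banach spaces\<close>

definition ell1 :: "(nat \<Rightarrow> real) normed_module" where
  "ell1 = \<lparr>carrier = {a. summable (\<lambda>n. \<bar>a n\<bar>)},
     monoid.mult = undefined, one = undefined,
     ring.zero = (\<lambda>n. 0), add = (\<lambda>a b n. a n + b n),
     module.smult = (\<lambda>c a n. c * a n),
     vnorm = (\<lambda>a. \<Sum>n. \<bar>a n\<bar>)\<rparr>"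

definition Rosenthal_space :: "('v, 'n) normed_module_scheme \<Rightarrow> bool" where
  "Rosenthal_space V \<longleftrightarrow> Banach_space V \<and>
     \<not> (\<exists>L. linear_between ell1 V L \<and> embedding_map (norm_topology ell1) (norm_topology V) L)"


subsection \<open>The dual space and the isometry group\<close>

text \<open>
  Functionals and operators are extensional (\<^term>\<open>undefined\<close> outside the carrier), so that they
  are determined by their values on the carrier and are points of a product space over it.
\<close>

definition dual_space :: "('v, 'n) normed_module_scheme \<Rightarrow> ('v \<Rightarrow> real) set" where
  "dual_space V = {f \<in> extensional (carrier V).
     (\<forall>u\<in>carrier V. \<forall>v\<in>carrier V. f (u \<oplus>\<^bsub>V\<^esub> v) = f u + f v) \<and>
     (\<forall>c. \<forall>v\<in>carrier V. f (c \<odot>\<^bsub>V\<^esub> v) = c * f v) \<and>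
     (\<exists>C. \<forall>v\<in>carrier V. \<bar>f v\<bar> \<le> C * vnorm V v)}"

definition dual_norm :: "('v, 'n) normed_module_scheme \<Rightarrow> ('v \<Rightarrow> real) \<Rightarrow> real" where
  "dual_norm V f = (SUP v\<in>{v \<in> carrier V. vnorm V v \<le> 1}. \<bar>f v\<bar>)"

definition weak_star_topology :: "('v, 'n) normed_module_scheme \<Rightarrow> ('v \<Rightarrow> real) topology" where
  "weak_star_topology V =
     subtopology (product_topology (\<lambda>_. euclideanreal) (carrier V)) (dual_space V)"

definition isometries :: "('v, 'n) normed_module_scheme \<Rightarrow> ('v \<Rightarrow> 'v) set" where
  "isometries V = {L \<in> extensional (carrier V). linear_between V V L \<and>
     L ` carrier V = carrier V \<and> (\<forall>v\<in>carrier V. vnorm V (L v) = vnorm V v)}"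

definition strong_operator_topology :: "('v, 'n) normed_module_scheme \<Rightarrow> ('v \<Rightarrow> 'v) topology" where
  "strong_operator_topology V =
     subtopology (product_topology (\<lambda>_. norm_topology V) (carrier V)) (isometries V)"


section \<open>Representations of actions on Banach spaces\<close>

definition representation ::
    "('g, 'm) monoid_scheme \<Rightarrow> 'g topology \<Rightarrow> 'a topology \<Rightarrow> ('g \<Rightarrow> 'a \<Rightarrow> 'a) \<Rightarrow>
     ('v, 'n) normed_module_scheme \<Rightarrow> ('g \<Rightarrow> 'v \<Rightarrow> 'v) \<Rightarrow> ('a \<Rightarrow> 'v \<Rightarrow> real) \<Rightarrow> bool" where
  "representation G T Y \<phi> V h \<alpha> \<longleftrightarrow>
     continuous_map T (strong_operator_topology V) h \<and>
     (\<forall>g\<^sub>1\<in>carrier G. \<forall>g\<^sub>2\<in>carrier G. h (g\<^sub>1 \<otimes>\<^bsub>G\<^esub> g\<^sub>2) = compose (carrier V) (h g\<^sub>2) (h g\<^sub>1)) \<and>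
     continuous_map Y (weak_star_topology V) \<alpha> \<and>
     (\<exists>C. \<forall>x\<in>topspace Y. dual_norm V (\<alpha> x) \<le> C) \<and>
     (\<forall>v\<in>carrier V. \<forall>g\<in>carrier G. \<forall>x\<in>topspace Y. \<alpha> (\<phi> g x) v = \<alpha> x (h g v))"

text \<open>
  HOL cannot quantify over types inside a formula, so one type has to host all candidates for the
  Banach space. The type \<^typ>\<open>'a \<Rightarrow> real\<close> of real functions on the phase space \<open>Y\<close> loses nothing. Let
  \<open>(h, \<alpha>)\<close> be a representation on a Rosenthal space \<open>V\<close> living in any type, with \<open>\<alpha>\<close> an embedding,
  and let \<open>N\<close> be the closed invariant subspace of those \<open>v\<close> that every \<open>\<alpha> x\<close> annihilates. Then
  \<open>V / N\<close> is again Rosenthal because \<open>\<ell>\<^sub>1\<close> lifts through quotient maps, \<open>(h, \<alpha>)\<close> descends to it, and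
  \<open>v \<mapsto> (x \<mapsto> \<alpha> x v)\<close> maps it injectively into the functions on \<open>Y\<close>.
  The operations and the norm on the carrier are arbitrary, not necessarily pointwise.
\<close>

definition Rosenthal_representable ::
    "('g, 'm) monoid_scheme \<Rightarrow> 'g topology \<Rightarrow> 'a topology \<Rightarrow> ('g \<Rightarrow> 'a \<Rightarrow> 'a) \<Rightarrow> bool" where
  "Rosenthal_representable G T Y \<phi> \<longleftrightarrow>
     (\<exists>(V :: ('a \<Rightarrow> real) normed_module) h \<alpha>. Rosenthal_space V \<and>
        representation G T Y \<phi> V h \<alpha> \<and> embedding_map Y (weak_star_topology V) \<alpha>)"


section \<open>Tame systems\<close>

definition independent_sequence :: "'a set \<Rightarrow> (nat \<Rightarrow> 'a \<Rightarrow> real) \<Rightarrow> bool" where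
  "independent_sequence S f \<longleftrightarrow> (\<exists>a b. a < b \<and>
     (\<forall>P M. finite P \<and> finite M \<and> P \<inter> M = {} \<longrightarrow>
        {x \<in> S. (\<forall>n\<in>P. f n x < a) \<and> (\<forall>n\<in>M. b < f n x)} \<noteq> {}))"

definition tame_system ::
    "('g, 'm) monoid_scheme \<Rightarrow> 'a topology \<Rightarrow> ('g \<Rightarrow> 'a \<Rightarrow> 'a) \<Rightarrow> bool" where
  "tame_system G Y \<phi> \<longleftrightarrow>
     (\<forall>f. continuous_map Y euclideanreal f \<longrightarrow>
        \<not> (\<exists>F :: nat \<Rightarrow> 'a \<Rightarrow> real. range F \<subseteq> (\<lambda>g x. f (\<phi> g x)) ` carrier G \<and>
             independent_sequence (topspace Y) F))"

end

theory Submission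
  imports Defs
begin

text \<open>
  A continuous \<open>f : D \<rightarrow> [0, 1]\<close> is called monotone if its sets \<open>{f < r}\<close> and \<open>{r < f}\<close> are connected
  and any two levels of f are separated by a cut point. Urysohn's construction along a dyadic scale of
  cut points shows that these functions separate the points of a dendron D. Their superlevel sets are
  pairwise noncrossing, so n of them generate at most n + 1 cells. This has two consequences.

  First, a continuous function on D is controlled, up to a given error, by finitely many monotone
  functions, so N of its translates have only linearly many patterns in N, too few for independence.

  Second, by the fourth moment method the average over all signs of the supremum norm of
  \<open>\<plusminus>f\<^sub>1 \<plusminus> \<dots> \<plusminus> f\<^sub>N\<close> is o(N), uniformly over monotone \<open>f\<^sub>i\<close>. The average is convex in each \<open>f\<^sub>i\<close>, hence
  the bound passes to the absolutely convex hull W of the monotone functions. Let V be the space of all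
  continuous f such that the K-functional between the gauge of W and the supremum norm, at the
  scales \<open>2\<^sup>n\<close>, tends to 0, with the supremum over n as norm. A gliding hump shows that V contains no
  copy of \<open>\<ell>\<^sub>1\<close>. The group acts on V by isometries, strongly continuously because at each scale the
  K-functional is equivalent to the supremum norm, and D embeds into the dual by evaluation.
\<close>

section \<open>Normed spaces with a carrier\<close>

text \<open>Two simpler spaces fail. The space of all continuous functions with the supremum norm
  carries the isometric action, but for D = [0, 1] it contains a copy of l_1. The span of W with its
  gauge as norm has few patterns, but for D = [0, 1] that gauge is equivalent to the supremum norm
  plus the total variation, in which f (g x) in general does not depend continuously on g.
  Interpolation between the two keeps both virtues. The fourth moment is the first even one that
  suffices. The supremum of a signed sum of N functions is read off a net of about N M points. With
  second moments, at most N at each point, the bound t <= a + t^2 / a at a = \<eta> N leaves a term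
  of order N. Fourth moments, at most 3 N^2 at each point, against a^3 leave a term that is bounded
  in N. The average is estimated, rather than the supremum for one good choice of signs, because a
  good choice depends on the functions and does not survive convex combinations.\<close>

context Normed_space
begin

lemma scalars: "carrier (ring_of_type_algebra :: real ring) = UNIV"
  "\<one>\<^bsub>ring_of_type_algebra :: real ring\<^esub> = 1" "\<zero>\<^bsub>ring_of_type_algebra :: real ring\<^esub> = 0"
  by (simp_all add: ring_of_type_algebra_def)

lemma scalars_minus: "\<ominus>\<^bsub>ring_of_type_algebra :: real ring\<^esub> c = - c"
  by (rule R.minus_equality) (simp_all add: ring_of_type_algebra_def)

lemma smult_mem: "v \<in> carrier V \<Longrightarrow> c \<odot>\<^bsub>V\<^esub> v \<in> carrier V"
  by (simp add: scalars)

lemma smult_minus_one: "v \<in> carrier V \<Longrightarrow> (- 1) \<odot>\<^bsub>V\<^esub> v = \<ominus>\<^bsub>V\<^esub> v"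
  using smult_l_minus[of 1 v] smult_one[of v] by (simp add: scalars scalars_minus)

lemma vnorm_zero: "vnorm V \<zero>\<^bsub>V\<^esub> = 0"
  using vnorm_eq_0_iff by simp

lemma vnorm_minus: "v \<in> carrier V \<Longrightarrow> vnorm V (\<ominus>\<^bsub>V\<^esub> v) = vnorm V v"
  using vnorm_smult[of v "-1"] by (simp add: smult_minus_one)

lemma Metric_space_vdist: "Metric_space (carrier V) (vdist V)"
proof
  fix u v show "0 \<le> vdist V u v"
    by (simp add: vdist_def vnorm_nonneg)
next
  fix u v show "vdist V u v = vdist V v u"
  proof (cases "u \<in> carrier V \<and> v \<in> carrier V")
    case True
    then have "\<ominus>\<^bsub>V\<^esub> (u \<ominus>\<^bsub>V\<^esub> v) = v \<ominus>\<^bsub>V\<^esub> u"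
      by (simp add: M.minus_eq M.minus_add M.a_comm)
    then show ?thesis
      using True vnorm_minus[of "u \<ominus>\<^bsub>V\<^esub> v"] by (simp add: vdist_def)
  qed (auto simp: vdist_def)
next
  fix u v assume "u \<in> carrier V" "v \<in> carrier V"
  moreover from this have "u = (u \<ominus>\<^bsub>V\<^esub> v) \<oplus>\<^bsub>V\<^esub> v"
    by (simp add: M.minus_eq M.a_assoc M.l_neg)
  ultimately show "vdist V u v = 0 \<longleftrightarrow> u = v"
    by (auto simp: vdist_def vnorm_eq_0_iff M.minus_eq M.r_neg)
next
  fix u v w assume uvw: "u \<in> carrier V" "v \<in> carrier V" "w \<in> carrier V"
  then have "u \<ominus>\<^bsub>V\<^esub> w = (u \<ominus>\<^bsub>V\<^esub> v) \<oplus>\<^bsub>V\<^esub> (v \<ominus>\<^bsub>V\<^esub> w)"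
    by (simp add: M.minus_eq M.a_assoc M.r_neg2 M.r_neg1)
  then show "vdist V u w \<le> vdist V u v + vdist V v w"
    using vnorm_triangle[of "u \<ominus>\<^bsub>V\<^esub> v" "v \<ominus>\<^bsub>V\<^esub> w"] uvw by (simp add: vdist_def)
qed

sublocale metric: Metric_space "carrier V" "vdist V"
  by (rule Metric_space_vdist)

lemma vdist_zero: "v \<in> carrier V \<Longrightarrow> vdist V \<zero>\<^bsub>V\<^esub> v = vnorm V v"
  by (simp add: vdist_def M.minus_eq vnorm_minus)

lemma topspace_norm_topology: "topspace (norm_topology V) = carrier V"
  by (simp add: norm_topology_def)

lemma zero_ball_open: "openin (norm_topology V) {v \<in> carrier V. vnorm V v < r}"
proof -
  have "{v \<in> carrier V. vnorm V v < r} = metric.mball \<zero>\<^bsub>V\<^esub> r"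
    by (auto simp: metric.mball_def vdist_zero)
  then show ?thesis by (simp add: norm_topology_def)
qed

lemma zero_ball_in_open:
  assumes "openin (norm_topology V) U" "\<zero>\<^bsub>V\<^esub> \<in> U"
  shows "\<exists>r>0. \<forall>v\<in>carrier V. vnorm V v < r \<longrightarrow> v \<in> U"
proof -
  obtain r where "0 < r" "metric.mball \<zero>\<^bsub>V\<^esub> r \<subseteq> U"
    using assms by (auto simp: norm_topology_def metric.openin_mtopology)
  then show ?thesis
    by (intro exI[of _ r]) (auto simp: metric.mball_def vdist_zero)
qed

lemma vnorm_normalize:
  assumes "v \<in> carrier V" "v \<noteq> \<zero>\<^bsub>V\<^esub>" "0 \<le> r"
  shows "vnorm V ((r / vnorm V v) \<odot>\<^bsub>V\<^esub> v) = r"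
  using assms vnorm_eq_0_iff[of v] vnorm_nonneg[of v] by (simp add: vnorm_smult)

end

text \<open>Both bounds come from balls around zero: continuity of \<open>L\<close> gives the upper
  one, openness of \<open>L\<close> onto its image the lower one, and homogeneity carries them to
  all vectors.\<close>

lemma linear_embedding_bounds:
  assumes "Normed_space U" "Normed_space V" and lin: "linear_between U V L"
    and emb: "embedding_map (norm_topology U) (norm_topology V) L"
  obtains c C where "0 < c" "\<And>u. u \<in> carrier U \<Longrightarrow> c * vnorm U u \<le> vnorm V (L u)"
    "\<And>u. u \<in> carrier U \<Longrightarrow> vnorm V (L u) \<le> C * vnorm U u"
proof -
  interpret U: Normed_space U by fact
  interpret V: Normed_space V by fact
  have L: "L u \<in> carrier V" if "u \<in> carrier U" for u
    using lin that by (auto simp: linear_between_def)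
  have Ls: "L (a \<odot>\<^bsub>U\<^esub> u) = a \<odot>\<^bsub>V\<^esub> L u" if "u \<in> carrier U" for a u
    using lin that by (auto simp: linear_between_def)
  have L0: "L \<zero>\<^bsub>U\<^esub> = \<zero>\<^bsub>V\<^esub>"
  proof -
    have "vnorm V (L (0 \<odot>\<^bsub>U\<^esub> \<zero>\<^bsub>U\<^esub>)) = 0"
      unfolding Ls[OF U.M.zero_closed] using V.vnorm_smult[OF L, of "\<zero>\<^bsub>U\<^esub>" 0] by simp
    moreover have "0 \<odot>\<^bsub>U\<^esub> \<zero>\<^bsub>U\<^esub> = \<zero>\<^bsub>U\<^esub>"
      using U.vnorm_smult[of "\<zero>\<^bsub>U\<^esub>" 0] U.vnorm_eq_0_iff[OF U.smult_mem, of "\<zero>\<^bsub>U\<^esub>" 0] by simp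
    ultimately show ?thesis using V.vnorm_eq_0_iff[OF L] by simp
  qed
  have hom: "homeomorphic_map (norm_topology U) (subtopology (norm_topology V) (L ` carrier U)) L"
    using emb by (simp add: embedding_map_def U.topspace_norm_topology)
  have inj: "inj_on L (carrier U)"
    using homeomorphic_imp_injective_map[OF hom] by (simp add: U.topspace_norm_topology)
  have cont: "continuous_map (norm_topology U) (norm_topology V) L"
    using homeomorphic_imp_continuous_map[OF hom] by (simp add: continuous_map_in_subtopology)
  have "openin (norm_topology U)
      {u \<in> topspace (norm_topology U). L u \<in> {v \<in> carrier V. vnorm V v < 1}}"
    by (rule openin_continuous_map_preimage[OF cont V.zero_ball_open])
  moreover have "\<zero>\<^bsub>U\<^esub> \<in> {u \<in> topspace (norm_topology U). L u \<in> {v \<in> carrier V. vnorm V v < 1}}"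
    by (simp add: U.topspace_norm_topology L0 V.vnorm_zero)
  ultimately have "\<exists>r>0. \<forall>u\<in>carrier U. vnorm U u < r \<longrightarrow>
      u \<in> {u \<in> topspace (norm_topology U). L u \<in> {v \<in> carrier V. vnorm V v < 1}}"
    by (rule U.zero_ball_in_open)
  then obtain r where r: "0 < r"
    "\<And>u. u \<in> carrier U \<Longrightarrow> vnorm U u < r \<Longrightarrow> vnorm V (L u) < 1"
    by auto
  have "openin (subtopology (norm_topology V) (L ` carrier U)) (L ` {u \<in> carrier U. vnorm U u < 1})"
    using homeomorphic_imp_open_map[OF hom] U.zero_ball_open by (auto simp: open_map_def)
  then obtain W where W: "openin (norm_topology V) W"
    "L ` {u \<in> carrier U. vnorm U u < 1} = W \<inter> L ` carrier U"
    by (auto simp: openin_subtopology)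
  have "\<zero>\<^bsub>V\<^esub> \<in> L ` {u \<in> carrier U. vnorm U u < 1}"
    using L0 U.vnorm_zero by (intro image_eqI[of _ _ "\<zero>\<^bsub>U\<^esub>"]) auto
  then have "\<zero>\<^bsub>V\<^esub> \<in> W" using W(2) by simp
  from V.zero_ball_in_open[OF W(1) this]
  obtain s where s: "0 < s" "\<And>v. v \<in> carrier V \<Longrightarrow> vnorm V v < s \<Longrightarrow> v \<in> W"
    by auto
  have small: "vnorm U u < 1" if u: "u \<in> carrier U" "vnorm V (L u) < s" for u
  proof -
    have "L u \<in> L ` {u \<in> carrier U. vnorm U u < 1}"
      using W s(2)[OF L] u by blast
    then show ?thesis using inj u(1) by (auto dest: inj_onD)
  qed
  show thesis
  proof (rule that)
    show "0 < s" by fact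
  next
    fix u assume u: "u \<in> carrier U"
    show "s * vnorm U u \<le> vnorm V (L u)"
    proof (cases "u = \<zero>\<^bsub>U\<^esub>")
      case False
      then have pos: "0 < vnorm U u" using U.vnorm_nonneg[OF u] U.vnorm_eq_0_iff[OF u] by simp
      have "\<not> vnorm V (L ((1 / vnorm U u) \<odot>\<^bsub>U\<^esub> u)) < s"
        using small[OF U.smult_mem[OF u]] U.vnorm_normalize[OF u False, of 1] by fastforce
      then have "s \<le> vnorm V (L u) / vnorm U u"
        using pos by (simp add: Ls[OF u] V.vnorm_smult[OF L[OF u]] not_less)
      then show ?thesis using pos by (simp add: pos_le_divide_eq)
    qed (simp add: L0 U.vnorm_zero V.vnorm_zero)
  next
    fix u assume u: "u \<in> carrier U"
    \<comment> \<open>Vectors are scaled to norm r / 2, strictly inside the ball of radius r; hence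
      the factor 2.\<close>
    show "vnorm V (L u) \<le> 2 / r * vnorm U u"
    proof (cases "u = \<zero>\<^bsub>U\<^esub>")
      case False
      then have pos: "0 < vnorm U u" using U.vnorm_nonneg[OF u] U.vnorm_eq_0_iff[OF u] by simp
      have "vnorm U ((r / 2 / vnorm U u) \<odot>\<^bsub>U\<^esub> u) < r"
        using U.vnorm_normalize[OF u False, of "r / 2"] r(1) by simp
      then have "r / 2 / vnorm U u * vnorm V (L u) < 1"
        using r(2)[OF U.smult_mem[OF u], of "r / 2 / vnorm U u"] r(1) pos
        by (simp add: Ls[OF u] V.vnorm_smult[OF L[OF u]])
      then show ?thesis using pos r(1) by (simp add: field_simps)
    qed (simp add: L0 U.vnorm_zero V.vnorm_zero)
  qed
qed

section \<open>The space of summable sequences as a normed space\<close>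

lemma ell1_simps:
  "carrier ell1 = {a. summable (\<lambda>n. \<bar>a n\<bar>)}" "\<zero>\<^bsub>ell1\<^esub> = (\<lambda>_. 0)"
  "a \<oplus>\<^bsub>ell1\<^esub> b = (\<lambda>n. a n + b n)" "c \<odot>\<^bsub>ell1\<^esub> a = (\<lambda>n. c * a n)"
  "vnorm ell1 a = (\<Sum>n. \<bar>a n\<bar>)"
  by (simp_all add: ell1_def)

lemma summable_abs_add:
  fixes a b :: "nat \<Rightarrow> real"
  assumes "summable (\<lambda>n. \<bar>a n\<bar>)" "summable (\<lambda>n. \<bar>b n\<bar>)"
  shows "summable (\<lambda>n. \<bar>a n + b n\<bar>)"
  by (rule summable_comparison_test'[OF summable_add[OF assms]]) (simp add: abs_triangle_ineq)

lemma ell1_Normed_space: "Normed_space ell1"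
proof -
  have "abelian_group ell1"
  proof (rule abelian_groupI)
    fix a assume "a \<in> carrier ell1"
    then show "\<exists>b\<in>carrier ell1. b \<oplus>\<^bsub>ell1\<^esub> a = \<zero>\<^bsub>ell1\<^esub>"
      by (intro bexI[of _ "\<lambda>n. - a n"]) (auto simp: ell1_simps)
  qed (auto simp: ell1_simps summable_abs_add add_ac)
  then have "module (ring_of_type_algebra :: real ring) ell1"
    by (intro moduleI[OF cring_from_type_algebra])
      (auto simp: ell1_simps ring_of_type_algebra_def abs_mult summable_mult algebra_simps)
  moreover have "Normed_space_axioms ell1"
  proof
    fix a b :: "nat \<Rightarrow> real" assume "a \<in> carrier ell1" "b \<in> carrier ell1"
    then have ab: "summable (\<lambda>n. \<bar>a n\<bar>)" "summable (\<lambda>n. \<bar>b n\<bar>)" by (auto simp: ell1_simps)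
    show "vnorm ell1 (a \<oplus>\<^bsub>ell1\<^esub> b) \<le> vnorm ell1 a + vnorm ell1 b"
      unfolding ell1_simps suminf_add[OF ab]
      by (intro suminf_le summable_abs_add summable_add ab abs_triangle_ineq)
  next
    fix a :: "nat \<Rightarrow> real" assume "a \<in> carrier ell1"
    then have a: "summable (\<lambda>n. \<bar>a n\<bar>)" by (auto simp: ell1_simps)
    show "0 \<le> vnorm ell1 a" using a by (simp add: ell1_simps suminf_nonneg)
    show "vnorm ell1 a = 0 \<longleftrightarrow> a = \<zero>\<^bsub>ell1\<^esub>"
      using suminf_eq_zero_iff[OF a] by (auto simp: ell1_simps)
    fix c show "vnorm ell1 (c \<odot>\<^bsub>ell1\<^esub> a) = \<bar>c\<bar> * vnorm ell1 a"
      using suminf_mult[OF a, of "\<bar>c\<bar>"] by (simp add: ell1_simps abs_mult)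
  qed
  ultimately show ?thesis by (rule Normed_space.intro)
qed


section \<open>The supremum norm\<close>

text \<open>The supremum runs over the whole type. The functions to which it will be applied vanish
  off the phase space, so it is their supremum norm there.\<close>

definition supn :: "('a \<Rightarrow> real) \<Rightarrow> real" where
  "supn f = (SUP x. \<bar>f x\<bar>)"

lemma abs_le_supn:
  assumes "bounded (range f)"
  shows "\<bar>f x\<bar> \<le> supn f"
proof -
  obtain C where "\<And>x. \<bar>f x\<bar> \<le> C"
    using assms by (auto simp: bounded_iff)
  then show ?thesis
    unfolding supn_def by (intro cSUP_upper bdd_aboveI2[of _ _ C]) auto
qed

lemma supn_le:
  assumes "\<And>x. \<bar>f x\<bar> \<le> c"
  shows "supn f \<le> c"
  unfolding supn_def using assms by (intro cSUP_least) auto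

lemma bounded_rangeI:
  fixes f :: "'a \<Rightarrow> real"
  assumes "\<And>x. \<bar>f x\<bar> \<le> c"
  shows "bounded (range f)"
  using assms by (auto simp: bounded_iff)

lemma supn_nonneg: "bounded (range f) \<Longrightarrow> 0 \<le> supn f"
  using abs_le_supn[of f undefined] by linarith

lemma bounded_range_add:
  fixes f g :: "'a \<Rightarrow> real"
  shows "bounded (range f) \<Longrightarrow> bounded (range g) \<Longrightarrow> bounded (range (\<lambda>x. f x + g x))"
  by (rule bounded_plus_comp)

lemma bounded_range_diff:
  fixes f g :: "'a \<Rightarrow> real"
  shows "bounded (range f) \<Longrightarrow> bounded (range g) \<Longrightarrow> bounded (range (\<lambda>x. f x - g x))"
  by (rule bounded_minus_comp)

lemma bounded_range_mult:
  fixes f :: "'a \<Rightarrow> real"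
  assumes "bounded (range f)"
  shows "bounded (range (\<lambda>x. c * f x))"
  using bounded_scaling[OF assms, of c] by (simp add: image_image)

lemma bounded_range_sum:
  fixes f :: "'i \<Rightarrow> 'a \<Rightarrow> real"
  assumes "\<And>i. i \<in> I \<Longrightarrow> bounded (range (f i))"
  shows "bounded (range (\<lambda>x. \<Sum>i\<in>I. f i x))"
  using assms
proof (induction I rule: infinite_finite_induct)
  case (insert i I)
  then show ?case
    using bounded_range_add[of "f i" "\<lambda>x. \<Sum>i\<in>I. f i x"] by simp
qed (auto intro: bounded_rangeI[where c = 0])

lemmas bounded_range_intros = bounded_range_add bounded_range_diff bounded_range_mult

lemma supn_add_le:
  assumes "bounded (range f)" "bounded (range g)"
  shows "supn (\<lambda>x. f x + g x) \<le> supn f + supn g"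
proof (rule supn_le)
  fix x show "\<bar>f x + g x\<bar> \<le> supn f + supn g"
    using abs_le_supn[OF assms(1), of x] abs_le_supn[OF assms(2), of x] by linarith
qed

lemma supn_mult_le:
  assumes "bounded (range f)"
  shows "supn (\<lambda>x. c * f x) \<le> \<bar>c\<bar> * supn f"
  by (rule supn_le) (simp add: abs_mult abs_le_supn[OF assms] mult_left_mono)


section \<open>Averages over signs\<close>

text \<open>The expectation of \<open>\<Phi>\<close> at \<open>s\<close> plus the sum of the first
  \<open>n\<close> functions with independent fair signs. The signs are drawn one by one, and
  \<open>s\<close> accumulates the terms already drawn.\<close>

primrec sign_average ::
    "(('a \<Rightarrow> real) \<Rightarrow> real) \<Rightarrow> (nat \<Rightarrow> 'a \<Rightarrow> real) \<Rightarrow> nat \<Rightarrow> ('a \<Rightarrow> real) \<Rightarrow> real" where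
  "sign_average \<Phi> w 0 s = \<Phi> s"
| "sign_average \<Phi> w (Suc n) s =
     (sign_average \<Phi> w n (\<lambda>x. s x + w n x) + sign_average \<Phi> w n (\<lambda>x. s x - w n x)) / 2"

lemma sign_average_cong:
  assumes "\<And>i. i < n \<Longrightarrow> v i = w i"
  shows "sign_average \<Phi> v n s = sign_average \<Phi> w n s"
  using assms by (induction n arbitrary: s) auto

text \<open>The comparison is assumed only at signed sums of the \<open>w i\<close>: the bound of a
  supremum by values on a finite net holds for these, not for arbitrary functions.\<close>

lemma sign_average_mono:
  assumes "\<And>\<epsilon>. (\<And>i. \<bar>\<epsilon> i\<bar> = 1) \<Longrightarrow>
      \<Phi> (\<lambda>x. s x + (\<Sum>i<n. \<epsilon> i * w i x)) \<le> \<Psi> (\<lambda>x. s x + (\<Sum>i<n. \<epsilon> i * w i x))"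
  shows "sign_average \<Phi> w n s \<le> sign_average \<Psi> w n s"
  using assms
proof (induction n arbitrary: s)
  case 0
  from 0[of "\<lambda>_. 1"] show ?case by simp
next
  case (Suc n)
  have *: "sign_average \<Phi> w n (\<lambda>x. s x + c * w n x) \<le> sign_average \<Psi> w n (\<lambda>x. s x + c * w n x)"
    if "\<bar>c\<bar> = 1" for c
  proof (rule Suc.IH)
    fix \<epsilon> :: "nat \<Rightarrow> real" assume e: "\<And>i. \<bar>\<epsilon> i\<bar> = 1"
    have "(\<lambda>x. s x + (\<Sum>i<Suc n. (\<epsilon>(n := c)) i * w i x)) =
        (\<lambda>x. s x + c * w n x + (\<Sum>i<n. \<epsilon> i * w i x))"
      by (rule ext) simp
    with Suc.prems[of "\<epsilon>(n := c)"] e that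
    show "\<Phi> (\<lambda>x. s x + c * w n x + (\<Sum>i<n. \<epsilon> i * w i x)) \<le>
        \<Psi> (\<lambda>x. s x + c * w n x + (\<Sum>i<n. \<epsilon> i * w i x))"
      by simp
  qed
  from *[of 1] *[of "-1"] show ?case
    by simp
qed

text \<open>An average is at least its smallest value: at each sign keep the half with the smaller
  average. This turns a bound on averages into actual signs for
  \<open>small_signed_sum\<close>.\<close>

lemma sign_average_attained:
  "\<exists>\<epsilon> :: nat \<Rightarrow> real. (\<forall>i. \<bar>\<epsilon> i\<bar> = 1) \<and>
     \<Phi> (\<lambda>x. s x + (\<Sum>i<n. \<epsilon> i * w i x)) \<le> sign_average \<Phi> w n s"
proof (induction n arbitrary: s)
  case 0
  show ?case by (rule exI[of _ "\<lambda>_. 1"]) auto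
next
  case (Suc n)
  obtain c :: real where c: "\<bar>c\<bar> = 1"
    "sign_average \<Phi> w n (\<lambda>x. s x + c * w n x) \<le> sign_average \<Phi> w (Suc n) s"
  proof (cases "sign_average \<Phi> w n (\<lambda>x. s x + w n x) \<le> sign_average \<Phi> w n (\<lambda>x. s x - w n x)")
    case True
    then show ?thesis by (intro that[of 1]) auto
  next
    case False
    then show ?thesis by (intro that[of "-1"]) auto
  qed
  obtain \<epsilon> :: "nat \<Rightarrow> real" where e: "\<forall>i. \<bar>\<epsilon> i\<bar> = 1"
    "\<Phi> (\<lambda>x. s x + c * w n x + (\<Sum>i<n. \<epsilon> i * w i x)) \<le>
      sign_average \<Phi> w n (\<lambda>x. s x + c * w n x)"
    using Suc.IH[of "\<lambda>x. s x + c * w n x"] by (elim exE conjE)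
  have "(\<lambda>x. s x + (\<Sum>i<Suc n. (\<epsilon>(n := c)) i * w i x)) =
      (\<lambda>x. s x + c * w n x + (\<Sum>i<n. \<epsilon> i * w i x))"
    by (rule ext) simp
  then show ?case
    using e c by (intro exI[of _ "\<epsilon>(n := c)"]) auto
qed

text \<open>Negating one function only swaps the two halves where its sign is drawn.\<close>

lemma sign_average_uminus:
  "sign_average \<Phi> (w(k := \<lambda>x. - f x)) n s = sign_average \<Phi> (w(k := f)) n s"
  by (induction n arbitrary: s) auto

section \<open>Convexity of averaged supremum norms\<close>

lemma supn_convex:
  assumes "bounded (range f)" "bounded (range g)" "0 \<le> l" "l \<le> 1"
  shows "supn (\<lambda>x. l * f x + (1 - l) * g x) \<le> l * supn f + (1 - l) * supn g"
proof -
  have "supn (\<lambda>x. l * f x + (1 - l) * g x) \<le> supn (\<lambda>x. l * f x) + supn (\<lambda>x. (1 - l) * g x)"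
    by (intro supn_add_le bounded_range_mult assms)
  also have "\<dots> \<le> l * supn f + (1 - l) * supn g"
    using supn_mult_le[OF assms(1), of l] supn_mult_le[OF assms(2), of "1 - l"] assms by simp
  finally show ?thesis .
qed

lemma convex_average:
  fixes l :: real
  assumes "a \<le> l * c + (1 - l) * e" "b \<le> l * d + (1 - l) * f"
  shows "(a + b) / 2 \<le> l * ((c + d) / 2) + (1 - l) * ((e + f) / 2)"
  using assms by (simp add: field_simps)

text \<open>Serves the induction for \<open>sign_average_supn_convex\<close>: when the sign of the
  modified function is drawn, that function moves from the family into the shift.\<close>

lemma sign_average_supn_convex_shift:
  assumes "\<And>i. i < n \<Longrightarrow> bounded (range (w i))" "bounded (range s)" "bounded (range t)"
    "0 \<le> l" "l \<le> 1"
  shows "sign_average supn w n (\<lambda>x. l * s x + (1 - l) * t x) \<le>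
    l * sign_average supn w n s + (1 - l) * sign_average supn w n t"
  using assms(1-3)
proof (induction n arbitrary: s t)
  case 0
  then show ?case using supn_convex assms(4,5) by simp
next
  case (Suc n)
  have *: "sign_average supn w n (\<lambda>x. l * s x + (1 - l) * t x + c * w n x) \<le>
      l * sign_average supn w n (\<lambda>x. s x + c * w n x) +
      (1 - l) * sign_average supn w n (\<lambda>x. t x + c * w n x)" for c
  proof -
    have "(\<lambda>x. l * s x + (1 - l) * t x + c * w n x) =
        (\<lambda>x. l * (s x + c * w n x) + (1 - l) * (t x + c * w n x))"
      by (simp add: algebra_simps)
    then show ?thesis
      using Suc.IH[of "\<lambda>x. s x + c * w n x" "\<lambda>x. t x + c * w n x"] Suc.prems
      by (simp add: bounded_range_intros)
  qed
  show ?case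
    unfolding sign_average.simps by (rule convex_average) (use *[of 1] *[of "-1"] in simp_all)
qed

lemma sign_average_supn_convex:
  assumes "\<And>i. i < n \<Longrightarrow> bounded (range (w i))" "bounded (range s)"
    "bounded (range f)" "bounded (range g)" "0 \<le> l" "l \<le> 1"
  shows "sign_average supn (w(k := \<lambda>x. l * f x + (1 - l) * g x)) n s \<le>
    l * sign_average supn (w(k := f)) n s + (1 - l) * sign_average supn (w(k := g)) n s"
  using assms(1,2)
proof (induction n arbitrary: s)
  case 0
  show ?case by (simp add: algebra_simps)
next
  case (Suc n)
  show ?case
  proof (cases "k = n")
    case True
    have eq: "sign_average supn (w(n := h)) n s' = sign_average supn w n s'" for h s'
      by (rule sign_average_cong) auto
    have *: "sign_average supn w n (\<lambda>x. s x + c * (l * f x + (1 - l) * g x)) \<le>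
        l * sign_average supn w n (\<lambda>x. s x + c * f x) +
        (1 - l) * sign_average supn w n (\<lambda>x. s x + c * g x)" for c
    proof -
      have "(\<lambda>x. s x + c * (l * f x + (1 - l) * g x)) =
          (\<lambda>x. l * (s x + c * f x) + (1 - l) * (s x + c * g x))"
        by (simp add: algebra_simps)
      then show ?thesis
        using sign_average_supn_convex_shift[of n w "\<lambda>x. s x + c * f x" "\<lambda>x. s x + c * g x" l]
          Suc.prems assms(3-6)
        by (simp add: bounded_range_intros)
    qed
    show ?thesis
      unfolding True sign_average.simps fun_upd_same eq
      by (rule convex_average) (use *[of 1] *[of "-1"] in \<open>simp_all add: algebra_simps\<close>)
  next
    case False
    have *: "sign_average supn (w(k := \<lambda>x. l * f x + (1 - l) * g x)) n (\<lambda>x. s x + c * w n x) \<le>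
        l * sign_average supn (w(k := f)) n (\<lambda>x. s x + c * w n x) +
        (1 - l) * sign_average supn (w(k := g)) n (\<lambda>x. s x + c * w n x)" for c
      using Suc.prems by (intro Suc.IH) (auto intro!: bounded_range_intros)
    show ?thesis
      unfolding sign_average.simps fun_upd_other[OF False[symmetric]]
      by (rule convex_average) (use *[of 1] *[of "-1"] in simp_all)
  qed
qed

text \<open>The constants \<open>c\<close> and \<open>d\<close> are carried along because the
  function to be averaged in \<open>sign_average_F_le\<close> is affine in the sum of fourth
  powers.\<close>

lemma sign_average_fourth_moment:
  assumes "\<And>i x. i < n \<Longrightarrow> x \<in> Z \<Longrightarrow> \<bar>w i x\<bar> \<le> 1"
  shows "sign_average (\<lambda>s. c + d * (\<Sum>x\<in>Z. s x ^ 4)) w n s \<le>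
    c + \<bar>d\<bar> * (\<Sum>x\<in>Z. s x ^ 4 + 6 * real n * s x ^ 2 + 3 * real n ^ 2)"
  using assms
proof (induction n arbitrary: s)
  case 0
  have "d * (\<Sum>x\<in>Z. s x ^ 4) \<le> \<bar>d\<bar> * (\<Sum>x\<in>Z. s x ^ 4)"
    by (intro mult_right_mono sum_nonneg) auto
  then show ?case by simp
next
  case (Suc n)
  \<comment> \<open>The fourth moment of t plus m random signs is t^4 + 6 m t^2 + 3 m^2 - 2 m.
    Dropping the last term leaves a bound that reproduces itself in the induction.\<close>
  define P where "P m t = t ^ 4 + 6 * real m * t ^ 2 + 3 * real m ^ 2" for m and t :: real
  have *: "P n (t + a) + P n (t - a) \<le> 2 * P (Suc n) t" if "\<bar>a\<bar> \<le> 1" for t a :: real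
  proof -
    have a2: "a\<^sup>2 \<le> 1" using that by (simp add: abs_square_le_1)
    have a4: "a ^ 4 \<le> 1" using power_mono[OF a2, of 2] by simp
    have "P n (t + a) + P n (t - a) =
        2 * (t ^ 4 + 6 * t\<^sup>2 * a\<^sup>2 + a ^ 4 + 6 * real n * (t\<^sup>2 + a\<^sup>2) + 3 * (real n)\<^sup>2)"
      unfolding P_def by (simp add: power4_eq_xxxx power2_eq_square algebra_simps)
    also have "\<dots> \<le> 2 * (t ^ 4 + 6 * t\<^sup>2 * 1 + 1 + 6 * real n * (t\<^sup>2 + 1) + 3 * (real n)\<^sup>2)"
      using a2 a4 by (intro mult_left_mono add_mono order_refl) auto
    also have "\<dots> \<le> 2 * P (Suc n) t"
      unfolding P_def by (simp add: power2_eq_square algebra_simps)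
    finally show ?thesis .
  qed
  have "sign_average (\<lambda>s. c + d * (\<Sum>x\<in>Z. s x ^ 4)) w (Suc n) s \<le>
      (c + \<bar>d\<bar> * (\<Sum>x\<in>Z. P n (s x + w n x)) + (c + \<bar>d\<bar> * (\<Sum>x\<in>Z. P n (s x - w n x)))) / 2"
    using Suc.IH[of "\<lambda>x. s x + w n x"] Suc.IH[of "\<lambda>x. s x - w n x"] Suc.prems
    by (simp add: P_def)
  also have "\<dots> = c + \<bar>d\<bar> * ((\<Sum>x\<in>Z. P n (s x + w n x) + P n (s x - w n x)) / 2)"
    by (simp add: sum.distrib algebra_simps)
  also have "(\<Sum>x\<in>Z. P n (s x + w n x) + P n (s x - w n x)) \<le> (\<Sum>x\<in>Z. 2 * P (Suc n) (s x))"
    using Suc.prems by (intro sum_mono *) auto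
  also have "\<dots> = 2 * (\<Sum>x\<in>Z. P (Suc n) (s x))"
    by (rule sum_distrib_left[symmetric])
  finally show ?case
    by (simp add: P_def mult_left_mono)
qed


section \<open>Noncrossing families\<close>

text \<open>Cross-free sets in the sense of combinatorics: relative to \<open>S\<close> the two sets
  are disjoint, nested, or together all of \<open>S\<close>.\<close>

definition noncrossing :: "'a set \<Rightarrow> ('a \<Rightarrow> bool) \<Rightarrow> ('a \<Rightarrow> bool) \<Rightarrow> bool" where
  "noncrossing S P Q \<longleftrightarrow> \<not> (\<exists>x\<in>S. \<exists>y\<in>S. \<exists>z\<in>S. \<exists>t\<in>S.
     P x \<and> Q x \<and> P y \<and> \<not> Q y \<and> \<not> P z \<and> Q z \<and> \<not> P t \<and> \<not> Q t)"

text \<open>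
  A new set that crosses none of the old ones splits at most one of the cells they generate, since
  any two cells lie on different sides of one of the old sets.
\<close>

lemma noncrossing_cells:
  assumes "finite I" "\<And>i j. i \<in> I \<Longrightarrow> j \<in> I \<Longrightarrow> noncrossing S (c i) (c j)"
  shows "\<exists>Z\<subseteq>S. finite Z \<and> card Z \<le> card I + 1 \<and> (\<forall>x\<in>S. \<exists>y\<in>Z. \<forall>i\<in>I. c i x = c i y)"
  using assms
proof (induction I rule: finite_induct)
  case empty
  show ?case
  proof (cases "S = {}")
    case False
    then obtain a where "a \<in> S" by blast
    then show ?thesis by (intro exI[of _ "{a}"]) auto
  qed auto
next
  case (insert k I)
  then obtain Z where Z: "Z \<subseteq> S" "finite Z" "card Z \<le> card I + 1"
    "\<And>x. x \<in> S \<Longrightarrow> \<exists>y\<in>Z. \<forall>i\<in>I. c i x = c i y"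
    by auto
  show ?case
  \<comment> \<open>If the new set splits a cell, \<open>a\<close> and \<open>b\<close> represent
    its two halves, and \<open>b\<close> is the only point to be added.\<close>
  proof (cases "\<exists>a\<in>Z. \<exists>b\<in>S. (\<forall>i\<in>I. c i a = c i b) \<and> c k a \<noteq> c k b")
    case False
    then have "\<forall>x\<in>S. \<exists>y\<in>Z. \<forall>i\<in>insert k I. c i x = c i y"
      using Z(4) by (metis insert_iff)
    moreover have "card Z \<le> card (insert k I) + 1"
      using Z insert.hyps by simp
    ultimately show ?thesis using Z by blast
  next
    case True
    then obtain a b where ab: "a \<in> Z" "b \<in> S" "\<forall>i\<in>I. c i a = c i b" "c k a \<noteq> c k b"
      by blast
    have "\<exists>y\<in>insert b Z. \<forall>i\<in>insert k I. c i x = c i y" if x: "x \<in> S" for x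
    proof -
      obtain y where y: "y \<in> Z" "\<forall>i\<in>I. c i x = c i y" using Z(4)[OF x] by blast
      consider "c k x = c k y" | "c k x \<noteq> c k y" "\<forall>i\<in>I. c i y = c i a"
        | i where "c k x \<noteq> c k y" "i \<in> I" "c i y \<noteq> c i a"
        by blast
      then show ?thesis
      proof cases
        case 1
        then show ?thesis using y by auto
      next
        case 2
        then show ?thesis using y ab by (metis insert_iff)
      next
        \<comment> \<open>The set \<open>i\<close> separates the cell of \<open>x\<close> and
          \<open>y\<close> from that of \<open>a\<close> and \<open>b\<close>, and the new set
          splits both cells: all four combinations occur.\<close>
        case (3 i)
        have "noncrossing S (c i) (c k)" using insert.prems 3 by blast
        moreover have "c i x = c i y" "c i a = c i b" "x \<in> S" "y \<in> S" "a \<in> S" "b \<in> S"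
          using y ab 3 x Z by auto
        ultimately have False
          using 3(1,3) ab(4) unfolding noncrossing_def by metis
        then show ?thesis ..
      qed
    qed
    moreover have "card (insert b Z) \<le> card (insert k I) + 1"
      using Z insert.hyps by (simp add: card_insert_if)
    ultimately show ?thesis
      using Z ab by (intro exI[of _ "insert b Z"]) auto
  qed
qed

text \<open>The average estimate and the interpolation space rest on these properties alone.
  Dendrons return when the monotone functions are shown to have them.\<close>

locale noncrossing_family =
  fixes Y :: "'a topology" and F :: "('a \<Rightarrow> real) set"
  assumes compact: "compact_space Y" and Hausdorff: "Hausdorff_space Y"
    and F_nonempty: "F \<noteq> {}"
    and F_continuous: "f \<in> F \<Longrightarrow> continuous_map Y euclideanreal f"
    and F_outside: "f \<in> F \<Longrightarrow> x \<notin> topspace Y \<Longrightarrow> f x = 0"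
    and F_nonneg: "f \<in> F \<Longrightarrow> 0 \<le> f x"
    and F_le_1: "f \<in> F \<Longrightarrow> f x \<le> 1"
    and F_separates: "x \<in> topspace Y \<Longrightarrow> y \<in> topspace Y \<Longrightarrow> x \<noteq> y \<Longrightarrow> \<exists>f\<in>F. f x \<noteq> f y"
    and F_noncrossing: "f \<in> F \<Longrightarrow> g \<in> F \<Longrightarrow>
      noncrossing (topspace Y) (\<lambda>x. r < f x) (\<lambda>x. s < g x)"
begin

lemma F_abs_le_1: "f \<in> F \<Longrightarrow> \<bar>f x\<bar> \<le> 1"
  using F_nonneg F_le_1 by (simp add: abs_le_iff order_trans)

lemma F_bounded: "f \<in> F \<Longrightarrow> bounded (range f)"
  using F_abs_le_1 by (intro bounded_rangeI)

text \<open>The superlevel sets at the heights j / M with j < M number \<open>card I * M\<close>,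
  and a function differs by at most 1 / M between points that none of its sets separates. Height 1
  is left out because no function exceeds it.\<close>

lemma F_net:
  assumes "finite I" "\<And>i. i \<in> I \<Longrightarrow> f i \<in> F" "0 < M"
  obtains Z where "Z \<subseteq> topspace Y" "finite Z" "card Z \<le> card I * M + 1"
    "\<And>x. x \<in> topspace Y \<Longrightarrow> \<exists>y\<in>Z. \<forall>i\<in>I. \<bar>f i x - f i y\<bar> \<le> 1 / real M"
proof -
  define c where "c p x \<longleftrightarrow> real (snd p) / real M < f (fst p) x" for p x
  have nc: "noncrossing (topspace Y) (c p) (c q)"
    if "p \<in> I \<times> {..<M}" "q \<in> I \<times> {..<M}" for p q
  proof -
    have "f (fst p) \<in> F" "f (fst q) \<in> F" using that assms(2) by auto
    then show ?thesis unfolding c_def by (rule F_noncrossing)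
  qed
  have "\<exists>Z\<subseteq>topspace Y. finite Z \<and> card Z \<le> card (I \<times> {..<M}) + 1 \<and>
      (\<forall>x\<in>topspace Y. \<exists>y\<in>Z. \<forall>p\<in>I \<times> {..<M}. c p x = c p y)"
    using assms(1) nc by (intro noncrossing_cells finite_cartesian_product finite_lessThan)
  then obtain Z where Z: "Z \<subseteq> topspace Y" "finite Z" "card Z \<le> card (I \<times> {..<M}) + 1"
    and cell: "\<forall>x\<in>topspace Y. \<exists>y\<in>Z. \<forall>p\<in>I \<times> {..<M}. c p x = c p y"
    by blast
  have le: "f i y - f i x \<le> 1 / real M"
    if i: "i \<in> I" and eq: "\<forall>p\<in>I \<times> {..<M}. c p x = c p y" for i x y
  proof (rule ccontr)
    assume "\<not> ?thesis"
    then have "1 / real M < f i y - f i x" by linarith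
    then have "1 < (f i y - f i x) * real M"
      using assms(3) by (simp only: pos_divide_less_eq of_nat_0_less_iff)
    then have gt: "f i x * real M + 1 < f i y * real M"
      unfolding left_diff_distrib by linarith
    \<comment> \<open>The height j / M is at least \<open>f i x\<close> and below
      \<open>f i y\<close>; it exists because the two values are more than 1 / M apart.\<close>
    define j where "j = nat \<lceil>f i x * real M\<rceil>"
    have nn: "0 \<le> f i x * real M" using F_nonneg assms i by simp
    then have j: "f i x * real M \<le> real j" "real j < f i x * real M + 1"
      unfolding j_def by linarith+
    have "f i y * real M \<le> 1 * real M"
      using F_le_1 assms i by (intro mult_right_mono) auto
    with j gt have "real j < real M" by linarith
    then have "c (i, j) x = c (i, j) y" using eq i by auto
    moreover have "c (i, j) y" "\<not> c (i, j) x"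
      unfolding c_def using assms(3) j gt by (simp_all add: pos_divide_less_eq)
    ultimately show False by simp
  qed
  show thesis
  proof (rule that[of Z])
    fix x assume "x \<in> topspace Y"
    with cell obtain y where y: "y \<in> Z" "\<forall>p\<in>I \<times> {..<M}. c p x = c p y"
      by blast
    then have "\<forall>i\<in>I. \<bar>f i x - f i y\<bar> \<le> 1 / real M"
      using le[of _ x y] le[of _ y x] by (auto simp: abs_le_iff)
    then show "\<exists>y\<in>Z. \<forall>i\<in>I. \<bar>f i x - f i y\<bar> \<le> 1 / real M" using y by blast
  qed (use Z assms in \<open>auto simp: card_cartesian_product\<close>)
qed

text \<open>The three terms are the loss in passing to a net of at most N M + 1 points, the
  threshold a = \<eta> N, and the fourth moments, at most 3 N^2 at each point of the net, divided by
  a^3.\<close>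

lemma sign_average_F_le:
  assumes w: "\<And>i. i < N \<Longrightarrow> w i \<in> F" and "0 < M" "0 < \<eta>" "0 < N"
  shows "sign_average supn w N (\<lambda>_. 0) \<le>
    real N / real M + \<eta> * real N + 3 * (real N * real M + 1) / (\<eta> ^ 3 * real N)"
proof -
  obtain Z where Z: "Z \<subseteq> topspace Y" "finite Z" "card Z \<le> card {..<N} * M + 1"
    "\<And>x. x \<in> topspace Y \<Longrightarrow> \<exists>y\<in>Z. \<forall>i\<in>{..<N}. \<bar>w i x - w i y\<bar> \<le> 1 / real M"
    using F_net[of "{..<N}" w M] assms by auto
  define a where "a = \<eta> * real N"
  have a: "0 < a" unfolding a_def using assms by simp
  define c where "c = real N / real M + a"
  \<comment> \<open>bounds the mean of a supremum by the sum of the fourth moments\<close>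
  have fourth: "t \<le> a + t ^ 4 / a ^ 3" if "0 \<le> t" for t :: real
  proof (cases "t \<le> a")
    case True
    have "0 \<le> t ^ 4 / a ^ 3" using a by simp
    with True show ?thesis by linarith
  next
    case False
    then have "a ^ 3 * t \<le> t ^ 3 * t"
      using a that by (intro mult_right_mono power_mono) auto
    moreover have "t ^ 3 * t = t ^ 4" by (simp add: eval_nat_numeral)
    ultimately have "t \<le> t ^ 4 / a ^ 3" using a by (simp add: pos_le_divide_eq mult.commute)
    then show ?thesis using a by simp
  qed
  have "sign_average supn w N (\<lambda>_. 0) \<le>
      sign_average (\<lambda>s. c + 1 / a ^ 3 * (\<Sum>x\<in>Z. s x ^ 4)) w N (\<lambda>_. 0)"
  proof (rule sign_average_mono)
    fix \<epsilon> :: "nat \<Rightarrow> real" assume e: "\<And>i. \<bar>\<epsilon> i\<bar> = 1"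
    define s where "s = (\<lambda>x. 0 + (\<Sum>i<N. \<epsilon> i * w i x))"
    have "supn s \<le> c + 1 / a ^ 3 * (\<Sum>x\<in>Z. s x ^ 4)"
    proof (rule supn_le)
      fix x
      have nn: "0 \<le> (\<Sum>x\<in>Z. s x ^ 4)" by (intro sum_nonneg) auto
      show "\<bar>s x\<bar> \<le> c + 1 / a ^ 3 * (\<Sum>x\<in>Z. s x ^ 4)"
      proof (cases "x \<in> topspace Y")
        case True
        then obtain y where y: "y \<in> Z" "\<And>i. i < N \<Longrightarrow> \<bar>w i x - w i y\<bar> \<le> 1 / real M"
          using Z(4) by blast
        have "\<bar>s x - s y\<bar> = \<bar>\<Sum>i<N. \<epsilon> i * (w i x - w i y)\<bar>"
          by (simp add: s_def sum_subtractf algebra_simps)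
        also have "\<dots> \<le> (\<Sum>i<N. \<bar>\<epsilon> i * (w i x - w i y)\<bar>)" by (rule sum_abs)
        also have "\<dots> \<le> (\<Sum>i<N. 1 / real M)"
          using y e by (intro sum_mono) (auto simp: abs_mult)
        finally have 1: "\<bar>s x - s y\<bar> \<le> real N / real M" by simp
        have "s y ^ 4 \<le> (\<Sum>x\<in>Z. s x ^ 4)"
          using y Z by (intro member_le_sum) auto
        then have "\<bar>s y\<bar> ^ 4 / a ^ 3 \<le> (\<Sum>x\<in>Z. s x ^ 4) / a ^ 3"
          using a by (intro divide_right_mono) auto
        with fourth[of "\<bar>s y\<bar>"] 1 show ?thesis
          unfolding c_def by simp
      next
        case False
        then have "s x = 0" unfolding s_def by (simp add: F_outside[OF w])
        then show ?thesis using nn a assms by (simp add: c_def)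
      qed
    qed
    then show "supn (\<lambda>x. 0 + (\<Sum>i<N. \<epsilon> i * w i x)) \<le>
        c + 1 / a ^ 3 * (\<Sum>x\<in>Z. (0 + (\<Sum>i<N. \<epsilon> i * w i x)) ^ 4)"
      unfolding s_def .
  qed
  also have "\<dots> \<le> c + \<bar>1 / a ^ 3\<bar> * (\<Sum>x\<in>Z. (0::real) ^ 4 + 6 * real N * 0 ^ 2 + 3 * real N ^ 2)"
    using w F_abs_le_1 by (intro sign_average_fourth_moment) auto
  also have "\<dots> = c + 3 * real N ^ 2 * real (card Z) / a ^ 3"
    using a by simp
  also have "\<dots> \<le> c + 3 * real N ^ 2 * (real N * real M + 1) / a ^ 3"
  proof -
    have "real (card Z) \<le> real (N * M + 1)" using Z(3) by (simp only: of_nat_le_iff) simp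
    then have "real (card Z) \<le> real N * real M + 1" by simp
    then show ?thesis
      using a by (intro add_left_mono divide_right_mono mult_left_mono) auto
  qed
  also have "3 * real N ^ 2 * (real N * real M + 1) / a ^ 3 =
      3 * (real N * real M + 1) / (\<eta> ^ 3 * real N)"
    unfolding a_def using assms by (simp add: power_mult_distrib power2_eq_square power3_eq_cube)
  finally show ?thesis unfolding c_def a_def by simp
qed

lemma sign_average_F_small:
  assumes "0 < \<epsilon>"
  obtains N where "0 < N"
    "\<And>w. (\<And>i. i < N \<Longrightarrow> w i \<in> F) \<Longrightarrow> sign_average supn w N (\<lambda>_. 0) \<le> \<epsilon> * real N"
proof -
  obtain M :: nat where M: "3 / \<epsilon> < real M" using reals_Archimedean2 by blast
  then have M0: "0 < M" using assms by (cases M) (auto simp: field_simps)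
  have M1: "1 / real M \<le> \<epsilon> / 3" using M M0 assms by (simp add: field_simps)
  define \<eta> where "\<eta> = \<epsilon> / 3"
  have eta: "0 < \<eta>" using assms by (simp add: \<eta>_def)
  \<comment> \<open>With \<open>M\<close> and \<open>\<eta>\<close> fixed, the last term is at most
    3 (M + 1) / \<eta>^3 for every positive N, so a large N makes it at most \<eta> N.\<close>
  obtain N :: nat where N: "3 * (real M + 1) / (\<eta> ^ 3 * \<eta>) < real N"
    using reals_Archimedean2 by blast
  have "0 < 3 * (real M + 1) / (\<eta> ^ 3 * \<eta>)" using eta by (intro divide_pos_pos) auto
  then have N0: "0 < N" using N by (cases N) auto
  have "3 * (real N * real M + 1) / (\<eta> ^ 3 * real N) \<le> 3 * (real N * (real M + 1)) / (\<eta> ^ 3 * real N)"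
    using eta N0 by (intro divide_right_mono mult_left_mono) (auto simp: algebra_simps)
  also have "\<dots> = 3 * (real M + 1) / \<eta> ^ 3" using N0 by simp
  also have "\<dots> \<le> \<eta> * real N"
    using N eta by (simp add: field_simps)
  finally have 1: "3 * (real N * real M + 1) / (\<eta> ^ 3 * real N) \<le> \<eta> * real N" .
  have 2: "real N / real M \<le> \<eta> * real N"
    using mult_right_mono[OF M1, of "real N"] by (simp add: \<eta>_def)
  show thesis
  proof (rule that[OF N0])
    fix w assume "\<And>i. i < N \<Longrightarrow> w i \<in> F"
    then have "sign_average supn w N (\<lambda>_. 0) \<le>
        real N / real M + \<eta> * real N + 3 * (real N * real M + 1) / (\<eta> ^ 3 * real N)"
      by (rule sign_average_F_le) (use M0 eta N0 in auto)
    also have "\<dots> \<le> \<eta> * real N + \<eta> * real N + \<eta> * real N"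
      using 1 2 by linarith
    also have "\<dots> = \<epsilon> * real N" by (simp add: \<eta>_def)
    finally show "sign_average supn w N (\<lambda>_. 0) \<le> \<epsilon> * real N" .
  qed
qed

end


section \<open>The absolutely convex hull\<close>

text \<open>Closure under binary combinations instead of finite sums: a bound that is convex in one
  function then passes to the hull by rule induction.\<close>

inductive_set abs_hull :: "('a \<Rightarrow> real) set \<Rightarrow> ('a \<Rightarrow> real) set" for F where
  zero: "(\<lambda>_. 0) \<in> abs_hull F"
| base: "f \<in> F \<Longrightarrow> f \<in> abs_hull F"
| uminus: "f \<in> F \<Longrightarrow> (\<lambda>x. - f x) \<in> abs_hull F"
| convex: "u \<in> abs_hull F \<Longrightarrow> v \<in> abs_hull F \<Longrightarrow> 0 \<le> l \<Longrightarrow> l \<le> 1 \<Longrightarrow>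
    (\<lambda>x. l * u x + (1 - l) * v x) \<in> abs_hull F"

lemma abs_hull_uminus: "w \<in> abs_hull F \<Longrightarrow> (\<lambda>x. - w x) \<in> abs_hull F"
proof (induction rule: abs_hull.induct)
  case (convex u v l)
  then have "(\<lambda>x. l * - u x + (1 - l) * - v x) \<in> abs_hull F"
    by (intro abs_hull.convex)
  then show ?case by (simp add: algebra_simps)
qed (auto intro: abs_hull.intros)

lemma abs_hull_scale:
  assumes "w \<in> abs_hull F" "\<bar>c\<bar> \<le> 1"
  shows "(\<lambda>x. c * w x) \<in> abs_hull F"
proof -
  have *: "(\<lambda>x. \<bar>c\<bar> * v x) \<in> abs_hull F" if "v \<in> abs_hull F" for v
    using abs_hull.convex[OF that abs_hull.zero, of "\<bar>c\<bar>"] assms by simp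
  show ?thesis
    using *[OF assms(1)] *[OF abs_hull_uminus[OF assms(1)]] by (cases "0 \<le> c") auto
qed

text \<open>This is the subadditivity of the gauge. In \<open>K_add_le\<close>, \<open>s\<close> and
  \<open>t\<close> are the multiples of the hull in two decompositions that are added.\<close>

lemma abs_hull_combine:
  assumes "u \<in> abs_hull F" "v \<in> abs_hull F" "0 \<le> s" "0 \<le> t"
  obtains w where "w \<in> abs_hull F" "\<And>x. s * u x + t * v x = (s + t) * w x"
proof (cases "s + t = 0")
  case True
  then have "s = 0" "t = 0" using assms by linarith+
  then show ?thesis using that[OF abs_hull.zero] by simp
next
  case False
  define l where "l = s / (s + t)"
  have l: "0 \<le> l" "l \<le> 1" "1 - l = t / (s + t)"
    using assms False by (auto simp: l_def field_simps)
  show ?thesis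
  proof (rule that[OF abs_hull.convex[OF assms(1,2) l(1,2)]])
    fix x show "s * u x + t * v x = (s + t) * (l * u x + (1 - l) * v x)"
      unfolding l(3) using False by (simp add: l_def distrib_left)
  qed
qed

lemma abs_hull_le_1:
  assumes "w \<in> abs_hull F" "\<And>f x. f \<in> F \<Longrightarrow> \<bar>f x\<bar> \<le> 1"
  shows "\<bar>w x\<bar> \<le> 1"
  using assms(1)
proof (induction rule: abs_hull.induct)
  case (convex u v l)
  have "\<bar>l * u x + (1 - l) * v x\<bar> \<le> l * \<bar>u x\<bar> + (1 - l) * \<bar>v x\<bar>"
    using convex.hyps by (intro order_trans[OF abs_triangle_ineq]) (simp add: abs_mult)
  also have "\<dots> \<le> l * 1 + (1 - l) * 1"
    using convex by (intro add_mono mult_left_mono) auto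
  finally show ?case by simp
qed (use assms(2) in auto)

text \<open>The functions are let into the hull one index at a time: at stage \<open>J\<close> the
  indices from \<open>J\<close> on still carry members of \<open>F\<close>. At a single index rule
  induction applies, by convexity of the average and its invariance under negation.\<close>

lemma sign_average_abs_hull_le:
  assumes F: "\<And>f. f \<in> F \<Longrightarrow> bounded (range f)" and "F \<noteq> {}"
    and B: "\<And>w. (\<And>i. i < N \<Longrightarrow> w i \<in> F) \<Longrightarrow> sign_average supn w N (\<lambda>_. 0) \<le> B"
    and w: "\<And>i. i < N \<Longrightarrow> w i \<in> abs_hull F"
  shows "sign_average supn w N (\<lambda>_. 0) \<le> B"
proof -
  have bdd: "bounded (range u)" if "u \<in> abs_hull F" for u
    using that
  proof (induction rule: abs_hull.induct)
    case zero
    show ?case by (rule bounded_rangeI[of _ 0]) simp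
  next
    case (uminus f)
    then show ?case using bounded_range_mult[OF F, of f "-1"] by simp
  next
    case (convex u v l)
    then show ?case by (intro bounded_range_add bounded_range_mult)
  qed (rule F)
  have zero: "bounded (range (\<lambda>_::'a. 0::real))" by (rule bounded_rangeI[of _ 0]) simp
  obtain g where g: "g \<in> F" using \<open>F \<noteq> {}\<close> by blast
  have "sign_average supn w N (\<lambda>_. 0) \<le> B"
    if "J \<le> N" "\<And>i. i < N \<Longrightarrow> w i \<in> abs_hull F" "\<And>i. J \<le> i \<Longrightarrow> i < N \<Longrightarrow> w i \<in> F"
    for J and w :: "nat \<Rightarrow> 'a \<Rightarrow> real"
    using that
  proof (induction J arbitrary: w)
    case 0
    then show ?case by (intro B) auto
  next
    case (Suc J)
    have base: "sign_average supn (w(J := f)) N (\<lambda>_. 0) \<le> B" if "f \<in> F" for f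
      using that Suc.prems by (intro Suc.IH) (auto intro: abs_hull.base)
    have conv: "sign_average supn (w(J := \<lambda>x. l * u x + (1 - l) * v x)) N (\<lambda>_. 0) \<le> B"
      if "sign_average supn (w(J := u)) N (\<lambda>_. 0) \<le> B" "sign_average supn (w(J := v)) N (\<lambda>_. 0) \<le> B"
        "0 \<le> l" "l \<le> 1" "bounded (range u)" "bounded (range v)" for u v l
    proof -
      have "sign_average supn (w(J := \<lambda>x. l * u x + (1 - l) * v x)) N (\<lambda>_. 0) \<le>
          l * sign_average supn (w(J := u)) N (\<lambda>_. 0) +
          (1 - l) * sign_average supn (w(J := v)) N (\<lambda>_. 0)"
        using that zero Suc.prems bdd by (intro sign_average_supn_convex) auto
      also have "\<dots> \<le> l * B + (1 - l) * B"
        using that by (intro add_mono mult_left_mono) auto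
      finally show ?thesis by (simp add: algebra_simps)
    qed
    have neg: "sign_average supn (w(J := \<lambda>x. - f x)) N (\<lambda>_. 0) \<le> B" if "f \<in> F" for f
      unfolding sign_average_uminus using base[OF that] .
    have "sign_average supn (w(J := u)) N (\<lambda>_. 0) \<le> B" if "u \<in> abs_hull F" for u
      using that
    proof (induction rule: abs_hull.induct)
      case zero
      \<comment> \<open>The zero function is treated as the midpoint of a generator and its
        negative.\<close>
      have "(\<lambda>x. 1/2 * g x + (1 - 1/2) * - g x) = (\<lambda>_. 0)" by simp
      then show ?case
        using conv[OF base[OF g] neg[OF g], of "1/2"] bdd[OF abs_hull.base[OF g]]
          bdd[OF abs_hull.uminus[OF g]] by (simp del: fun_upd_apply)
    next
      case (convex u v l)
      then show ?case by (intro conv bdd)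
    qed (fact base neg)+
    from this[of "w J"] Suc.prems show ?case by simp
  qed
  from this[of N w] w show ?thesis by simp
qed


section \<open>An interpolation space\<close>

text \<open>
  Real interpolation between the space spanned by the hull, with its gauge as norm, and the space
  of bounded functions, in the manner of Davis, Figiel, Johnson and Pelczynski.
\<close>

definition K_functional :: "('a \<Rightarrow> real) set \<Rightarrow> real \<Rightarrow> ('a \<Rightarrow> real) \<Rightarrow> real" where
  "K_functional F q f =
     (INF p\<in>{0..} \<times> abs_hull F. fst p / q + q * supn (\<lambda>x. f x - fst p * snd p x))"

context noncrossing_family
begin

abbreviation K where "K \<equiv> K_functional F"

section \<open>The K-functional at one scale\<close>

lemma hull_le_1:
  assumes "w \<in> abs_hull F"
  shows "\<bar>w x\<bar> \<le> 1"
  using assms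
proof (rule abs_hull_le_1)
  show "\<bar>f y\<bar> \<le> 1" if "f \<in> F" for f y
    using that by (rule F_abs_le_1)
qed

lemma hull_bounded: "w \<in> abs_hull F \<Longrightarrow> bounded (range w)"
  using hull_le_1 by (intro bounded_rangeI)

lemma hull_residual_bounded:
  "bounded (range f) \<Longrightarrow> w \<in> abs_hull F \<Longrightarrow> bounded (range (\<lambda>x. f x - t * w x))"
  by (rule bounded_range_diff, assumption, rule bounded_range_mult, rule hull_bounded)

lemma residual_nonneg:
  "bounded (range f) \<Longrightarrow> 0 < q \<Longrightarrow> w \<in> abs_hull F \<Longrightarrow> 0 \<le> q * supn (\<lambda>x. f x - t * w x)"
  by (intro mult_nonneg_nonneg supn_nonneg hull_residual_bounded) auto

lemma K_le:
  assumes "bounded (range f)" "0 < q" "0 \<le> t" "w \<in> abs_hull F"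
  shows "K q f \<le> t / q + q * supn (\<lambda>x. f x - t * w x)"
proof -
  have "bdd_below ((\<lambda>p. fst p / q + q * supn (\<lambda>x. f x - fst p * snd p x)) ` ({0..} \<times> abs_hull F))"
    using assms(1,2) by (intro bdd_belowI2[of _ 0]) (auto simp: residual_nonneg)
  from cINF_lower[OF this, of "(t, w)"] assms(3,4) show ?thesis
    by (simp add: K_functional_def)
qed

lemma K_ge:
  assumes "\<And>t w. 0 \<le> t \<Longrightarrow> w \<in> abs_hull F \<Longrightarrow> c \<le> t / q + q * supn (\<lambda>x. f x - t * w x)"
  shows "c \<le> K q f"
  unfolding K_functional_def
proof (rule cINF_greatest)
  have "(0, \<lambda>_. 0) \<in> {0::real..} \<times> abs_hull F" by (simp add: abs_hull.zero)
  then show "{0::real..} \<times> abs_hull F \<noteq> {}" by blast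
qed (use assms in auto)

lemma K_witness:
  assumes "K q f < c"
  obtains t w where "0 \<le> t" "w \<in> abs_hull F" "t / q + q * supn (\<lambda>x. f x - t * w x) < c"
  using K_ge[of c q f] assms by (meson not_le)

lemma K_nonneg: "bounded (range f) \<Longrightarrow> 0 < q \<Longrightarrow> 0 \<le> K q f"
  by (intro K_ge) (simp add: residual_nonneg)

lemma K_le_supn: "bounded (range f) \<Longrightarrow> 0 < q \<Longrightarrow> K q f \<le> q * supn f"
  using K_le[of f q 0 "\<lambda>_. 0"] by (simp add: abs_hull.zero)

text \<open>The decomposition with t = 1 leaves no residual. This decay in q is why the members of
  \<open>F\<close> lie in the interpolation space.\<close>

lemma K_abs_hull_le: "w \<in> abs_hull F \<Longrightarrow> 0 < q \<Longrightarrow> K q w \<le> 1 / q"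
proof -
  assume w: "w \<in> abs_hull F" and q: "0 < q"
  have "supn (\<lambda>x. w x - 1 * w x) \<le> 0" by (rule supn_le) simp
  then have "q * supn (\<lambda>x. w x - 1 * w x) \<le> 0"
    using q by (simp add: mult_le_0_iff)
  with K_le[OF hull_bounded[OF w] q _ w, of 1] show ?thesis by simp
qed

text \<open>In a decomposition of f the hull part is at most t, because hull functions are bounded
  by 1, and the residual r is at most q^2 r, because q is at least 1. The case q = 1 makes
  evaluations at points bounded functionals.\<close>

lemma supn_le_K:
  assumes "bounded (range f)" "1 \<le> q"
  shows "supn f \<le> q * K q f"
proof -
  have "supn f / q \<le> K q f"
  proof (rule K_ge)
    fix t w assume t: "0 \<le> (t::real)" "w \<in> abs_hull F"
    define r where "r = supn (\<lambda>x. f x - t * w x)"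
    have r: "\<bar>f x - t * w x\<bar> \<le> r" "0 \<le> r" for x
      unfolding r_def by (intro abs_le_supn supn_nonneg hull_residual_bounded assms t)+
    have "supn f \<le> t + r"
    proof (rule supn_le)
      fix x
      have "\<bar>t * w x\<bar> \<le> t * 1"
        unfolding abs_mult using t hull_le_1[of w x] by (intro mult_mono) auto
      then show "\<bar>f x\<bar> \<le> t + r" using r(1)[of x] by linarith
    qed
    also have "r \<le> q * q * r"
      using mult_mono[OF assms(2) assms(2)] assms(2) r mult_right_mono[of 1 "q * q" r] by simp
    finally have "supn f / q \<le> (t + q * q * r) / q"
      using assms(2) by (intro divide_right_mono) auto
    then show "supn f / q \<le> t / q + q * r" using assms(2) by (simp add: add_divide_distrib)
  qed
  then show ?thesis using assms(2) by (simp add: pos_divide_le_eq mult.commute)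
qed

lemma K_add_le:
  assumes "bounded (range f)" "bounded (range g)" "0 < q"
  shows "K q (\<lambda>x. f x + g x) \<le> K q f + K q g"
proof (rule field_le_epsilon)
  fix e :: real assume e: "0 < e"
  obtain s u where u: "0 \<le> s" "u \<in> abs_hull F"
    "s / q + q * supn (\<lambda>x. f x - s * u x) < K q f + e / 2"
    using K_witness[of q f "K q f + e / 2"] e by auto
  obtain t v where v: "0 \<le> t" "v \<in> abs_hull F"
    "t / q + q * supn (\<lambda>x. g x - t * v x) < K q g + e / 2"
    using K_witness[of q g "K q g + e / 2"] e by auto
  obtain w where w: "w \<in> abs_hull F" "\<And>x. s * u x + t * v x = (s + t) * w x"
    using abs_hull_combine u v by metis
  have "K q (\<lambda>x. f x + g x) \<le> (s + t) / q + q * supn (\<lambda>x. f x + g x - (s + t) * w x)"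
    by (intro K_le bounded_range_add assms w add_nonneg_nonneg u v)
  also have "(\<lambda>x. f x + g x - (s + t) * w x) = (\<lambda>x. (f x - s * u x) + (g x - t * v x))"
  proof
    fix x show "f x + g x - (s + t) * w x = (f x - s * u x) + (g x - t * v x)"
      using w(2)[of x] by linarith
  qed
  also have "supn \<dots> \<le> supn (\<lambda>x. f x - s * u x) + supn (\<lambda>x. g x - t * v x)"
    by (intro supn_add_le hull_residual_bounded assms u v)
  finally have "K q (\<lambda>x. f x + g x) \<le>
      (s + t) / q + q * (supn (\<lambda>x. f x - s * u x) + supn (\<lambda>x. g x - t * v x))"
    using assms by simp
  also have "\<dots> = (s / q + q * supn (\<lambda>x. f x - s * u x)) + (t / q + q * supn (\<lambda>x. g x - t * v x))"
    by (simp add: add_divide_distrib distrib_left)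
  finally show "K q (\<lambda>x. f x + g x) \<le> K q f + K q g + e"
    using u(3) v(3) by linarith
qed

lemma K_mult_le:
  assumes "bounded (range f)" "0 < q"
  shows "K q (\<lambda>x. c * f x) \<le> \<bar>c\<bar> * K q f"
proof (cases "c = 0")
  case True
  have "supn (\<lambda>_::'a. 0) \<le> 0" by (rule supn_le) simp
  then have "q * supn (\<lambda>_::'a. 0) \<le> 0" using assms(2) by (simp add: mult_le_0_iff)
  with True K_le_supn[of "\<lambda>x. c * f x" q] assms show ?thesis
    by (simp add: bounded_range_mult)
next
  case False
  have "K q (\<lambda>x. c * f x) / \<bar>c\<bar> \<le> K q f"
  proof (rule K_ge)
    fix t w assume t: "0 \<le> (t::real)" "w \<in> abs_hull F"
    \<comment> \<open>The hull is symmetric, so it absorbs the sign of \<open>c\<close> and its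
      multiple stays nonnegative.\<close>
    have w': "(\<lambda>x. sgn c * w x) \<in> abs_hull F"
      by (rule abs_hull_scale) (use t in \<open>auto simp: abs_sgn_eq\<close>)
    have "K q (\<lambda>x. c * f x) \<le> \<bar>c\<bar> * t / q + q * supn (\<lambda>x. c * f x - \<bar>c\<bar> * t * (sgn c * w x))"
      by (intro K_le bounded_range_mult assms w') (use t in auto)
    also have "(\<lambda>x. c * f x - \<bar>c\<bar> * t * (sgn c * w x)) = (\<lambda>x. c * (f x - t * w x))"
    proof
      fix x
      have "\<bar>c\<bar> * t * (sgn c * w x) = (sgn c * \<bar>c\<bar>) * t * w x" by simp
      then show "c * f x - \<bar>c\<bar> * t * (sgn c * w x) = c * (f x - t * w x)"
        by (simp add: sgn_mult_abs right_diff_distrib)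
    qed
    also have "supn \<dots> \<le> \<bar>c\<bar> * supn (\<lambda>x. f x - t * w x)"
      by (intro supn_mult_le hull_residual_bounded assms t)
    finally have "K q (\<lambda>x. c * f x) \<le> \<bar>c\<bar> * t / q + q * (\<bar>c\<bar> * supn (\<lambda>x. f x - t * w x))"
      using assms by simp
    also have "\<dots> = (t / q + q * supn (\<lambda>x. f x - t * w x)) * \<bar>c\<bar>"
      by (simp add: algebra_simps)
    finally show "K q (\<lambda>x. c * f x) / \<bar>c\<bar> \<le> t / q + q * supn (\<lambda>x. f x - t * w x)"
      using False by (simp add: pos_divide_le_eq)
  qed
  then show ?thesis using False by (simp add: pos_divide_le_eq mult.commute)
qed

lemma K_mult:
  assumes "bounded (range f)" "0 < q"
  shows "K q (\<lambda>x. c * f x) = \<bar>c\<bar> * K q f"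
proof (rule antisym)
  show "\<bar>c\<bar> * K q f \<le> K q (\<lambda>x. c * f x)"
  proof (cases "c = 0")
    case True
    then show ?thesis using K_nonneg[of "\<lambda>x. c * f x" q] assms by (simp add: bounded_range_mult)
  next
    case False
    have "K q (\<lambda>x. inverse c * (c * f x)) \<le> \<bar>inverse c\<bar> * K q (\<lambda>x. c * f x)"
      by (intro K_mult_le bounded_range_mult assms)
    then have "K q f \<le> \<bar>inverse c\<bar> * K q (\<lambda>x. c * f x)"
      using False by (simp flip: mult.assoc)
    then show ?thesis using False by (simp add: field_simps)
  qed
qed (use K_mult_le assms in auto)

lemma K_diff_le:
  assumes "bounded (range f)" "bounded (range g)" "0 < q"
  shows "K q (\<lambda>x. f x - g x) \<le> K q f + K q g"
  using K_add_le[OF assms(1) bounded_range_mult[OF assms(2), of "-1"] assms(3)]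
    K_mult[OF assms(2,3), of "-1"] by simp

section \<open>The normed space\<close>

definition interp_carrier :: "('a \<Rightarrow> real) set" where
  "interp_carrier = {f. continuous_map Y euclideanreal f \<and> (\<forall>x. x \<notin> topspace Y \<longrightarrow> f x = 0) \<and>
     (\<lambda>n. K (2 ^ n) f) \<longlonglongrightarrow> 0}"

text \<open>With the limit required in \<open>interp_carrier\<close> this is a c_0 sum over the
  scales, where the classical construction takes an l_2 sum. Small tails are what the gliding hump
  and the strong continuity of the action use.\<close>

definition interp_norm :: "('a \<Rightarrow> real) \<Rightarrow> real" where
  "interp_norm f = (SUP n. K (2 ^ n) f)"

definition interp_space :: "('a \<Rightarrow> real) normed_module" where
  "interp_space = \<lparr>carrier = interp_carrier, monoid.mult = undefined, one = undefined,
     ring.zero = (\<lambda>_. 0), add = (\<lambda>f g x. f x + g x), module.smult = (\<lambda>c f x. c * f x),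
     vnorm = interp_norm\<rparr>"

lemma continuous_outside_bounded:
  assumes "continuous_map Y euclideanreal f" "\<And>x. x \<notin> topspace Y \<Longrightarrow> f x = 0"
  shows "bounded (range f)"
proof -
  have "compactin euclideanreal (f ` topspace Y)"
    using image_compactin[OF _ assms(1), of "topspace Y"] compact by (simp add: compact_space_def)
  then have "bounded (f ` topspace Y)" by (simp add: compact_imp_bounded)
  then have "bounded (insert 0 (f ` topspace Y))" by simp
  then show ?thesis by (rule bounded_subset) (use assms(2) in auto)
qed

lemma interp_bounded: "f \<in> interp_carrier \<Longrightarrow> bounded (range f)"
  unfolding interp_carrier_def using continuous_outside_bounded by blast

lemma interp_zero_outside: "f \<in> interp_carrier \<Longrightarrow> x \<notin> topspace Y \<Longrightarrow> f x = 0"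
  unfolding interp_carrier_def by blast

lemma interp_continuous: "f \<in> interp_carrier \<Longrightarrow> continuous_map Y euclideanreal f"
  unfolding interp_carrier_def by blast

lemma interp_K_tendsto: "f \<in> interp_carrier \<Longrightarrow> (\<lambda>n. K (2 ^ n) f) \<longlonglongrightarrow> 0"
  unfolding interp_carrier_def by blast

lemma interp_bdd_above: "f \<in> interp_carrier \<Longrightarrow> bdd_above (range (\<lambda>n. K (2 ^ n) f))"
  using convergent_imp_Bseq[OF convergentI[OF interp_K_tendsto]]
  by (intro bounded_imp_bdd_above) (simp add: Bseq_eq_bounded)

lemma K_le_interp_norm: "f \<in> interp_carrier \<Longrightarrow> K (2 ^ n) f \<le> interp_norm f"
  unfolding interp_norm_def by (intro cSUP_upper interp_bdd_above) auto

lemma interp_norm_le: "(\<And>n. K (2 ^ n) f \<le> c) \<Longrightarrow> interp_norm f \<le> c"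
  unfolding interp_norm_def by (intro cSUP_least) auto

lemma supn_le_interp_norm: "f \<in> interp_carrier \<Longrightarrow> supn f \<le> interp_norm f"
  using supn_le_K[OF interp_bounded, of f 1] K_le_interp_norm[of f 0] by simp

lemma abs_le_interp_norm: "f \<in> interp_carrier \<Longrightarrow> \<bar>f x\<bar> \<le> interp_norm f"
  using abs_le_supn[OF interp_bounded, of f x] supn_le_interp_norm[of f] by linarith

lemma interp_norm_nonneg: "f \<in> interp_carrier \<Longrightarrow> 0 \<le> interp_norm f"
  using abs_le_interp_norm[of f undefined] by linarith

lemma interp_zero: "(\<lambda>_. 0) \<in> interp_carrier"
proof -
  have "K (2 ^ n) (\<lambda>_. 0) = 0" for n
    using K_mult[of "\<lambda>_. 0" "2 ^ n" 0] by (simp add: bounded_rangeI[of _ 0])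
  then show ?thesis unfolding interp_carrier_def by simp
qed

lemma interp_add:
  assumes "f \<in> interp_carrier" "g \<in> interp_carrier"
  shows "(\<lambda>x. f x + g x) \<in> interp_carrier"
proof -
  have "(\<lambda>n. K (2 ^ n) (\<lambda>x. f x + g x)) \<longlonglongrightarrow> 0"
  proof (rule tendsto_sandwich[where f = "\<lambda>_. 0" and h = "\<lambda>n. K (2 ^ n) f + K (2 ^ n) g"])
    show "(\<lambda>n. K (2 ^ n) f + K (2 ^ n) g) \<longlonglongrightarrow> 0"
      using tendsto_add[OF interp_K_tendsto[OF assms(1)] interp_K_tendsto[OF assms(2)]] by simp
  qed (auto intro!: always_eventually K_nonneg K_add_le bounded_range_add
      interp_bounded[OF assms(1)] interp_bounded[OF assms(2)])
  then show ?thesis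
    using assms by (simp add: interp_carrier_def continuous_map_add)
qed

lemma interp_mult:
  assumes "f \<in> interp_carrier"
  shows "(\<lambda>x. c * f x) \<in> interp_carrier"
proof -
  have "(\<lambda>n. K (2 ^ n) (\<lambda>x. c * f x)) \<longlonglongrightarrow> 0"
    using tendsto_mult_left[OF interp_K_tendsto[OF assms], of "\<bar>c\<bar>"]
    by (simp add: K_mult interp_bounded assms)
  then show ?thesis
    using assms by (simp add: interp_carrier_def continuous_map_real_mult_left)
qed

lemma interp_diff: "f \<in> interp_carrier \<Longrightarrow> g \<in> interp_carrier \<Longrightarrow> (\<lambda>x. f x - g x) \<in> interp_carrier"
  using interp_add[OF _ interp_mult[of g "-1"], of f] by simp

lemma F_subset_interp: "F \<subseteq> interp_carrier"
proof
  fix f assume f: "f \<in> F"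
  have "(\<lambda>n. K (2 ^ n) f) \<longlonglongrightarrow> 0"
  proof (rule tendsto_sandwich[where f = "\<lambda>_. 0" and h = "\<lambda>n. (1 / 2) ^ n"])
    show "\<forall>\<^sub>F n in sequentially. K (2 ^ n) f \<le> (1 / 2) ^ n"
      using K_abs_hull_le[OF abs_hull.base[OF f]] by (simp add: power_one_over)
    show "(\<lambda>n. (1 / 2 :: real) ^ n) \<longlonglongrightarrow> 0" by (rule LIMSEQ_power_zero) simp
  qed (auto intro!: always_eventually K_nonneg F_bounded f)
  then show "f \<in> interp_carrier"
    unfolding interp_carrier_def using F_continuous[OF f] F_outside[OF f] by blast
qed

lemma interp_norm_add_le:
  assumes "f \<in> interp_carrier" "g \<in> interp_carrier"
  shows "interp_norm (\<lambda>x. f x + g x) \<le> interp_norm f + interp_norm g"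
proof (rule interp_norm_le)
  fix n
  have "K (2 ^ n) (\<lambda>x. f x + g x) \<le> K (2 ^ n) f + K (2 ^ n) g"
    by (intro K_add_le interp_bounded assms) simp
  then show "K (2 ^ n) (\<lambda>x. f x + g x) \<le> interp_norm f + interp_norm g"
    using K_le_interp_norm[OF assms(1), of n] K_le_interp_norm[OF assms(2), of n] by linarith
qed

lemma interp_norm_mult:
  assumes "f \<in> interp_carrier"
  shows "interp_norm (\<lambda>x. c * f x) = \<bar>c\<bar> * interp_norm f"
proof -
  have le: "interp_norm (\<lambda>x. c * f x) \<le> \<bar>c\<bar> * interp_norm f" if "f \<in> interp_carrier" for c f
    using that K_le_interp_norm[OF that]
    by (intro interp_norm_le) (simp add: K_mult interp_bounded mult_left_mono)
  show ?thesis
  proof (cases "c = 0")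
    case True
    then show ?thesis
      using le[OF assms, of c] interp_norm_nonneg[OF interp_mult[OF assms], of c] by simp
  next
    case False
    have "interp_norm (\<lambda>x. inverse c * (c * f x)) \<le> \<bar>inverse c\<bar> * interp_norm (\<lambda>x. c * f x)"
      by (intro le interp_mult assms)
    then have "interp_norm f \<le> \<bar>inverse c\<bar> * interp_norm (\<lambda>x. c * f x)"
      using False by (simp flip: mult.assoc)
    then have "\<bar>c\<bar> * interp_norm f \<le> interp_norm (\<lambda>x. c * f x)"
      using False by (simp add: field_simps)
    with le[OF assms] show ?thesis by (rule antisym)
  qed
qed

lemma interp_space_simps:
  "carrier interp_space = interp_carrier" "\<zero>\<^bsub>interp_space\<^esub> = (\<lambda>_. 0)"
  "f \<oplus>\<^bsub>interp_space\<^esub> g = (\<lambda>x. f x + g x)" "c \<odot>\<^bsub>interp_space\<^esub> f = (\<lambda>x. c * f x)"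
  "vnorm interp_space = interp_norm"
  by (simp_all add: interp_space_def)

lemma interp_abelian_group: "abelian_group interp_space"
proof (rule abelian_groupI)
  fix f assume "f \<in> carrier interp_space"
  then show "\<exists>g\<in>carrier interp_space. g \<oplus>\<^bsub>interp_space\<^esub> f = \<zero>\<^bsub>interp_space\<^esub>"
    using interp_mult[of f "-1"]
    by (intro bexI[of _ "\<lambda>x. - 1 * f x"]) (simp_all add: interp_space_simps)
qed (auto simp: interp_space_simps interp_add interp_zero add_ac)

lemma interp_minus:
  assumes "f \<in> interp_carrier" "g \<in> interp_carrier"
  shows "f \<ominus>\<^bsub>interp_space\<^esub> g = (\<lambda>x. f x - g x)"
proof -
  interpret abelian_group interp_space by (rule interp_abelian_group)
  have "\<ominus>\<^bsub>interp_space\<^esub> g = (\<lambda>x. - 1 * g x)"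
    using interp_mult[of g "-1"] assms
    by (intro minus_equality) (simp_all add: interp_space_simps)
  then show ?thesis by (simp add: a_minus_def interp_space_simps)
qed

lemma interp_normed_space: "Normed_space interp_space"
proof -
  have "module (ring_of_type_algebra :: real ring) interp_space"
    by (rule moduleI[OF cring_from_type_algebra interp_abelian_group])
      (auto simp: interp_space_simps ring_of_type_algebra_def interp_mult algebra_simps)
  moreover have "Normed_space_axioms interp_space"
  proof
    fix f assume "f \<in> carrier interp_space"
    then have f: "f \<in> interp_carrier" by (simp add: interp_space_simps)
    have "f = (\<lambda>_. 0)" if "interp_norm f = 0"
      using abs_le_interp_norm[OF f] that by (simp add: fun_eq_iff)
    moreover have "interp_norm (\<lambda>_. 0) = 0"
      using interp_norm_mult[OF f, of 0] by simp
    ultimately show "vnorm interp_space f = 0 \<longleftrightarrow> f = \<zero>\<^bsub>interp_space\<^esub>"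
      by (auto simp: interp_space_simps)
  qed (simp_all add: interp_space_simps interp_norm_nonneg interp_norm_mult interp_norm_add_le)
  ultimately show ?thesis by (rule Normed_space.intro)
qed

lemma vdist_interp:
  "f \<in> interp_carrier \<Longrightarrow> g \<in> interp_carrier \<Longrightarrow> vdist interp_space f g = interp_norm (\<lambda>x. f x - g x)"
  by (simp add: vdist_def interp_space_simps interp_minus)

lemma interp_metric: "Metric_space interp_carrier (vdist interp_space)"
  using Normed_space.Metric_space_vdist[OF interp_normed_space] by (simp add: interp_space_simps)

sublocale interp: Metric_space interp_carrier "vdist interp_space"
  by (rule interp_metric)

text \<open>The norm dominates the supremum norm, so a Cauchy sequence converges uniformly. At a
  fixed scale the K-functional is bounded by a multiple of the supremum norm, so the Cauchy estimate
  passes to the limit, with one index for all scales.\<close>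

lemma interp_complete: "interp.mcomplete"
  unfolding interp.mcomplete_def
proof (intro allI impI)
  fix \<sigma> assume Cauchy: "interp.MCauchy \<sigma>"
  then have \<sigma>: "\<sigma> n \<in> interp_carrier" for n by (auto simp: interp.MCauchy_def)
  have small: "\<exists>N. \<forall>m\<ge>N. \<forall>n\<ge>N. interp_norm (\<lambda>x. \<sigma> m x - \<sigma> n x) < e" if "0 < e" for e
    using Cauchy that unfolding interp.MCauchy_def by (metis \<sigma> vdist_interp)
  have pointwise: "\<bar>\<sigma> m x - \<sigma> n x\<bar> \<le> interp_norm (\<lambda>x. \<sigma> m x - \<sigma> n x)" for m n x
    using abs_le_interp_norm[OF interp_diff[OF \<sigma> \<sigma>]] .
  have "Cauchy (\<lambda>n. \<sigma> n x)" for x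
    unfolding Cauchy_def dist_real_def using small pointwise by (meson order_le_less_trans)
  then have "convergent (\<lambda>n. \<sigma> n x)" for x
    by (rule Cauchy_convergent)
  then obtain f where f: "\<And>x. (\<lambda>n. \<sigma> n x) \<longlonglongrightarrow> f x"
    unfolding convergent_def by metis
  have uniform: "\<exists>N. \<forall>n\<ge>N. supn (\<lambda>x. \<sigma> n x - f x) \<le> e" if e: "0 < e" for e
  proof -
    obtain N where N: "\<And>m n. m \<ge> N \<Longrightarrow> n \<ge> N \<Longrightarrow> interp_norm (\<lambda>x. \<sigma> m x - \<sigma> n x) < e"
      using small[OF e] by blast
    have "supn (\<lambda>x. \<sigma> n x - f x) \<le> e" if n: "n \<ge> N" for n
    proof (rule supn_le)
      fix x
      have "(\<lambda>m. \<bar>\<sigma> n x - \<sigma> m x\<bar>) \<longlonglongrightarrow> \<bar>\<sigma> n x - f x\<bar>"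
        by (intro tendsto_intros f)
      moreover have "\<bar>\<sigma> n x - \<sigma> m x\<bar> \<le> e" if "m \<ge> N" for m
        using N[OF n that] pointwise[of n x m] by linarith
      ultimately show "\<bar>\<sigma> n x - f x\<bar> \<le> e"
        by (intro LIMSEQ_le_const2) blast+
    qed
    then show ?thesis by blast
  qed
  have f0: "f x = 0" if "x \<notin> topspace Y" for x
    using f[of x] interp_zero_outside[OF \<sigma> that] LIMSEQ_unique[of "\<lambda>_. 0" "f x" 0] by simp
  have bdd_f: "bounded (range f)"
  proof -
    obtain N where N: "\<And>m n. m \<ge> N \<Longrightarrow> n \<ge> N \<Longrightarrow> interp_norm (\<lambda>x. \<sigma> m x - \<sigma> n x) < 1"
      using small[of 1] by auto
    have "\<bar>f x\<bar> \<le> supn (\<sigma> N) + 1" for x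
    proof (rule LIMSEQ_le_const2)
      show "(\<lambda>n. \<bar>\<sigma> n x\<bar>) \<longlonglongrightarrow> \<bar>f x\<bar>" by (intro tendsto_intros f)
      show "\<exists>M. \<forall>n\<ge>M. \<bar>\<sigma> n x\<bar> \<le> supn (\<sigma> N) + 1"
      proof (intro exI[of _ N] allI impI)
        fix n assume "N \<le> n"
        then show "\<bar>\<sigma> n x\<bar> \<le> supn (\<sigma> N) + 1"
          using N[of n N] pointwise[of n x N] abs_le_supn[OF interp_bounded[OF \<sigma>], of N x] by linarith
      qed
    qed
    then show ?thesis by (rule bounded_rangeI)
  qed
  have bdd_diff: "bounded (range (\<lambda>x. \<sigma> n x - f x))" for n
    by (intro bounded_range_diff interp_bounded \<sigma> bdd_f)
  have cont: "continuous_map Y euclideanreal f"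
  proof -
    have "continuous_map Y Met_TC.mtopology f"
    proof (rule Met_TC.continuous_map_uniform_limit)
      show "\<forall>\<^sub>F n in sequentially. continuous_map Y Met_TC.mtopology (\<sigma> n)"
        using interp_continuous[OF \<sigma>] by simp
      fix e :: real assume e: "0 < e"
      obtain N where N: "\<And>n. n \<ge> N \<Longrightarrow> supn (\<lambda>x. \<sigma> n x - f x) \<le> e / 2"
        using uniform[of "e / 2"] e by auto
      have "\<bar>\<sigma> n x - f x\<bar> < e" if "n \<ge> N" for n x
        using abs_le_supn[OF bdd_diff[of n], of x] N[OF that] e by linarith
      then show "\<forall>\<^sub>F n in sequentially. \<forall>x\<in>topspace Y. f x \<in> UNIV \<and> dist (\<sigma> n x) (f x) < e"
        unfolding eventually_sequentially dist_real_def by blast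
    qed simp
    then show ?thesis by simp
  qed
  have Kdiff: "\<exists>N. \<forall>n\<ge>N. \<forall>k. K (2 ^ k) (\<lambda>x. \<sigma> n x - f x) \<le> e" if e: "0 < e" for e
  proof -
    obtain N where N: "\<And>m n. m \<ge> N \<Longrightarrow> n \<ge> N \<Longrightarrow> interp_norm (\<lambda>x. \<sigma> m x - \<sigma> n x) < e / 2"
      using small[of "e / 2"] e by auto
    have "K (2 ^ k) (\<lambda>x. \<sigma> n x - f x) \<le> e" if n: "n \<ge> N" for n k
    proof -
      \<comment> \<open>\<open>M\<close> depends on the scale \<open>k\<close>, but it only serves
        to choose the intermediate index \<open>m\<close>; the index \<open>N\<close> does not
        depend on \<open>k\<close>.\<close>
      obtain M where M: "\<And>m. m \<ge> M \<Longrightarrow> supn (\<lambda>x. \<sigma> m x - f x) \<le> e / 2 / 2 ^ k"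
        using uniform[of "e / 2 / 2 ^ k"] e by auto
      define m where "m = max M N"
      have "K (2 ^ k) (\<lambda>x. (\<sigma> n x - \<sigma> m x) + (\<sigma> m x - f x)) \<le>
          K (2 ^ k) (\<lambda>x. \<sigma> n x - \<sigma> m x) + K (2 ^ k) (\<lambda>x. \<sigma> m x - f x)"
        by (intro K_add_le bdd_diff bounded_range_diff interp_bounded \<sigma>) simp
      also have "K (2 ^ k) (\<lambda>x. \<sigma> m x - f x) \<le> 2 ^ k * supn (\<lambda>x. \<sigma> m x - f x)"
        by (intro K_le_supn bdd_diff) simp
      also have "\<dots> \<le> 2 ^ k * (e / 2 / 2 ^ k)"
        by (intro mult_left_mono M) (auto simp: m_def)
      also have "\<dots> = e / 2" by simp
      also have "K (2 ^ k) (\<lambda>x. \<sigma> n x - \<sigma> m x) \<le> e / 2"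
        using K_le_interp_norm[OF interp_diff[OF \<sigma>[of n] \<sigma>[of m]], of k] N[OF n, of m]
        by (simp add: m_def)
      finally show ?thesis by simp
    qed
    then show ?thesis by blast
  qed
  have "(\<lambda>k. K (2 ^ k) f) \<longlonglongrightarrow> 0"
    unfolding LIMSEQ_iff
  proof (intro allI impI)
    fix e :: real assume e: "0 < e"
    obtain n where n: "\<And>k. K (2 ^ k) (\<lambda>x. \<sigma> n x - f x) \<le> e / 2"
      using Kdiff[of "e / 2"] e by auto
    obtain k0 where k0: "\<And>k. k \<ge> k0 \<Longrightarrow> norm (K (2 ^ k) (\<sigma> n) - 0) < e / 2"
      using interp_K_tendsto[OF \<sigma>[of n]] e unfolding LIMSEQ_iff by (meson half_gt_zero)
    have "norm (K (2 ^ k) f - 0) < e" if "k \<ge> k0" for k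
    proof -
      have "K (2 ^ k) (\<lambda>x. \<sigma> n x - (\<sigma> n x - f x)) \<le> K (2 ^ k) (\<sigma> n) + K (2 ^ k) (\<lambda>x. \<sigma> n x - f x)"
        by (intro K_diff_le interp_bounded \<sigma> bdd_diff) simp
      then show ?thesis
        using n[of k] k0[OF that] K_nonneg[OF bdd_f, of "2 ^ k"] by simp
    qed
    then show "\<exists>k0. \<forall>k\<ge>k0. norm (K (2 ^ k) f - 0) < e" by blast
  qed
  with cont f0 have f_mem: "f \<in> interp_carrier" by (simp add: interp_carrier_def)
  have "\<exists>N. \<forall>n\<ge>N. \<sigma> n \<in> interp_carrier \<and> vdist interp_space (\<sigma> n) f < e" if e: "0 < e" for e
  proof -
    obtain N where N: "\<And>n k. n \<ge> N \<Longrightarrow> K (2 ^ k) (\<lambda>x. \<sigma> n x - f x) \<le> e / 2"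
      using Kdiff[of "e / 2"] e by auto
    have "vdist interp_space (\<sigma> n) f < e" if "n \<ge> N" for n
      using interp_norm_le[OF N[OF that]] e by (simp add: vdist_interp \<sigma> f_mem)
    then show ?thesis using \<sigma> by blast
  qed
  then show "\<exists>f. limitin interp.mtopology \<sigma> f sequentially"
    unfolding interp.limit_metric_sequentially using f_mem by blast
qed

lemma interp_Banach_space: "Banach_space interp_space"
  using interp_normed_space interp_complete
  by (intro Banach_space.intro Banach_space_axioms.intro) (simp_all add: interp_space_simps)

end


section \<open>The interpolation space contains no copy of the space of summable sequences\<close>

definition unit_seq :: "nat \<Rightarrow> nat \<Rightarrow> real" where
  "unit_seq i = (\<lambda>n. if n = i then 1 else 0)"

lemma sum_lessThan_add:
  fixes g :: "nat \<Rightarrow> real"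
  shows "(\<Sum>i<m + n. g i) = (\<Sum>i<m. g i) + (\<Sum>i<n. g (m + i))"
  by (induction n) auto

lemma finite_support_ell1:
  assumes "\<And>i. M \<le> i \<Longrightarrow> a i = 0"
  shows "a \<in> carrier ell1" "vnorm ell1 a = (\<Sum>i<M. \<bar>a i\<bar>)"
proof -
  have "(\<lambda>i. \<bar>a i\<bar>) sums (\<Sum>i<M. \<bar>a i\<bar>)"
    using assms by (intro sums_finite) auto
  then show "a \<in> carrier ell1" "vnorm ell1 a = (\<Sum>i<M. \<bar>a i\<bar>)"
    by (auto simp: ell1_simps sums_iff)
qed

context noncrossing_family
begin

text \<open>At one fixed scale all \<open>v i\<close> lie within \<open>e / 2\<close> of a common
  multiple \<open>T\<close> of the hull, and for functions in the hull the average over signs is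
  o(N).\<close>

lemma small_signed_sum:
  assumes v: "\<And>i. v i \<in> interp_carrier" "\<And>i. interp_norm (v i) \<le> C" and e: "0 < e"
  shows "\<exists>N \<epsilon>. 0 < N \<and> (\<forall>i::nat. \<bar>\<epsilon> i\<bar> = 1) \<and> (\<forall>x. \<bar>\<Sum>i<N. \<epsilon> i * v i x\<bar> \<le> e * real N)"
proof -
  have C: "0 \<le> C" using v interp_norm_nonneg order_trans by blast
  \<comment> \<open>A decomposition of K-value below C + 1 has residual below (C + 1) / q and hull
    multiple below q (C + 1). The former has to be at most e / 2, the latter becomes
    \<open>T\<close>. The added 1 makes the inequality for the witness strict and \<open>T\<close>
    positive.\<close>
  obtain n where n: "(C + 1) / 2 ^ n < e / 2"
  proof -
    obtain n where "2 * (C + 1) / e < 2 ^ n"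
      using real_arch_pow[of 2] by auto
    then show thesis using e by (intro that[of n]) (simp add: field_simps)
  qed
  define q :: real where "q = 2 ^ n"
  define T where "T = q * (C + 1)"
  have q: "0 < q" and T: "0 < T" using C by (simp_all add: q_def T_def)
  have "\<exists>t w. 0 \<le> t \<and> w \<in> abs_hull F \<and> t / q + q * supn (\<lambda>x. v i x - t * w x) < C + 1" for i
  proof -
    have "K q (v i) < C + 1"
      using K_le_interp_norm[OF v(1), of n i] v(2)[of i] by (simp add: q_def)
    then show ?thesis by (rule K_witness) blast
  qed
  then obtain t w where t: "\<And>i. 0 \<le> t i" and w: "\<And>i. w i \<in> abs_hull F"
    and tw: "\<And>i. t i / q + q * supn (\<lambda>x. v i x - t i * w i x) < C + 1"
    by metis
  have t_le: "t i \<le> T" for i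
  proof -
    have "t i / q < C + 1"
      using tw[of i] residual_nonneg[OF interp_bounded[OF v(1)] q w, of i "t i" i] by linarith
    then show ?thesis using q by (simp add: T_def pos_divide_less_eq mult.commute)
  qed
  have res: "\<bar>v i x - t i * w i x\<bar> \<le> e / 2" for i x
  proof -
    have "0 \<le> t i / q" using t q by simp
    then have "q * supn (\<lambda>x. v i x - t i * w i x) < C + 1" using tw[of i] by linarith
    then have "supn (\<lambda>x. v i x - t i * w i x) < (C + 1) / q"
      using q by (simp add: pos_less_divide_eq mult.commute)
    then have "supn (\<lambda>x. v i x - t i * w i x) < e / 2"
      using n unfolding q_def by linarith
    moreover have "bounded (range (\<lambda>x. v i x - t i * w i x))"
      by (intro hull_residual_bounded interp_bounded v w)
    ultimately show ?thesis
      using abs_le_supn[of "\<lambda>x. v i x - t i * w i x" x] by linarith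
  qed
  define u where "u i x = t i / T * w i x" for i x
  have u: "u i \<in> abs_hull F" for i
    unfolding u_def using t t_le T by (intro abs_hull_scale w) (auto simp: abs_le_iff)
  \<comment> \<open>After multiplication by \<open>T\<close> this leaves e / 2 per term for the hull
    parts, beside e / 2 for the residuals.\<close>
  obtain N where N: "0 < N" and
    avg: "\<And>w. (\<And>i. i < N \<Longrightarrow> w i \<in> F) \<Longrightarrow> sign_average supn w N (\<lambda>_. 0) \<le> e / (2 * T) * real N"
    using sign_average_F_small[of "e / (2 * T)"] e T by auto
  have "sign_average supn u N (\<lambda>_. 0) \<le> e / (2 * T) * real N"
    by (rule sign_average_abs_hull_le[OF F_bounded F_nonempty avg u])
  then obtain \<epsilon> :: "nat \<Rightarrow> real" where eps: "\<forall>i. \<bar>\<epsilon> i\<bar> = 1"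
    and "supn (\<lambda>x. 0 + (\<Sum>i<N. \<epsilon> i * u i x)) \<le> e / (2 * T) * real N"
    using sign_average_attained[of supn "\<lambda>_. 0" u N] by (meson order_trans)
  then have sum_u: "supn (\<lambda>x. \<Sum>i<N. \<epsilon> i * u i x) \<le> e / (2 * T) * real N" by simp
  have bdd: "bounded (range (\<lambda>x. \<Sum>i<N. \<epsilon> i * u i x))"
    by (intro bounded_range_sum bounded_range_mult hull_bounded u)
  have "\<bar>\<Sum>i<N. \<epsilon> i * v i x\<bar> \<le> e * real N" for x
  proof -
    have "\<epsilon> i * v i x = T * (\<epsilon> i * u i x) + \<epsilon> i * (v i x - t i * w i x)" for i
      using T by (simp add: u_def algebra_simps)
    then have "(\<Sum>i<N. \<epsilon> i * v i x) =
        T * (\<Sum>i<N. \<epsilon> i * u i x) + (\<Sum>i<N. \<epsilon> i * (v i x - t i * w i x))"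
      by (simp only: sum.distrib sum_distrib_left)
    also have "\<bar>\<dots>\<bar> \<le> \<bar>T * (\<Sum>i<N. \<epsilon> i * u i x)\<bar> + \<bar>\<Sum>i<N. \<epsilon> i * (v i x - t i * w i x)\<bar>"
      by (rule abs_triangle_ineq)
    also have "\<bar>T * (\<Sum>i<N. \<epsilon> i * u i x)\<bar> \<le> T * (e / (2 * T) * real N)"
      using abs_le_supn[OF bdd, of x] sum_u T by (simp only: abs_mult) (intro mult_mono, auto)
    also have "T * (e / (2 * T) * real N) = e / 2 * real N" using T by simp
    also have "\<bar>\<Sum>i<N. \<epsilon> i * (v i x - t i * w i x)\<bar> \<le> (\<Sum>i<N. \<bar>\<epsilon> i * (v i x - t i * w i x)\<bar>)"
      by (rule sum_abs)
    also have "\<dots> \<le> (\<Sum>i<N. e / 2)"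
      using eps res by (intro sum_mono) (simp add: abs_mult)
    finally show ?thesis by simp
  qed
  then show ?thesis using N eps by blast
qed

lemma linear_finite_support:
  assumes lin: "linear_between ell1 interp_space L" and a: "\<And>i. M \<le> i \<Longrightarrow> a i = 0"
  shows "L a = (\<lambda>x. \<Sum>i<M. a i * L (unit_seq i) x)"
  using a
proof (induction M arbitrary: a)
  case 0
  have "unit_seq 0 \<in> carrier ell1"
    by (rule finite_support_ell1(1)[of 1]) (simp add: unit_seq_def)
  then have "L (0 \<odot>\<^bsub>ell1\<^esub> unit_seq 0) = 0 \<odot>\<^bsub>interp_space\<^esub> L (unit_seq 0)"
    using lin unfolding linear_between_def by blast
  then have "L (\<lambda>n. 0) = (\<lambda>x. 0)"
    by (simp add: ell1_simps interp_space_simps)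
  moreover have "a = (\<lambda>n. 0)" using 0 by auto
  ultimately show ?case by simp
next
  case (Suc M)
  define b where "b = (\<lambda>n. if n < M then a n else 0)"
  have eq: "a = (\<lambda>n. b n + a M * unit_seq M n)"
  proof
    fix n
    consider "n < M" | "n = M" | "Suc M \<le> n" by linarith
    then show "a n = b n + a M * unit_seq M n"
      by cases (auto simp: b_def unit_seq_def Suc.prems)
  qed
  have mem: "b \<in> carrier ell1" "unit_seq M \<in> carrier ell1"
    by (rule finite_support_ell1(1)[of M], simp add: b_def)
      (rule finite_support_ell1(1)[of "Suc M"], simp add: unit_seq_def)
  then have mem': "(\<lambda>n. a M * unit_seq M n) \<in> carrier ell1"
    by (intro finite_support_ell1(1)[of "Suc M"]) (simp add: unit_seq_def)
  have "L (b \<oplus>\<^bsub>ell1\<^esub> (\<lambda>n. a M * unit_seq M n)) = L b \<oplus>\<^bsub>interp_space\<^esub> L (\<lambda>n. a M * unit_seq M n)"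
    using lin mem mem' unfolding linear_between_def by blast
  moreover have "L (a M \<odot>\<^bsub>ell1\<^esub> unit_seq M) = a M \<odot>\<^bsub>interp_space\<^esub> L (unit_seq M)"
    using lin mem unfolding linear_between_def by blast
  ultimately have "L (\<lambda>n. b n + a M * unit_seq M n) = (\<lambda>x. L b x + a M * L (unit_seq M) x)"
    by (simp add: ell1_simps interp_space_simps)
  moreover have "L b = (\<lambda>x. \<Sum>i<M. b i * L (unit_seq i) x)"
    by (rule Suc.IH) (simp add: b_def)
  ultimately show ?case
    using eq by (simp add: b_def)
qed

text \<open>
  Gliding hump: the K-functionals at the first scales are small on the next block because its
  supremum norm is small, those at the later scales are small on the preceding blocks. Hence sums of
  blocks stay bounded while their norms in \<open>\<ell>\<^sub>1\<close> grow.
\<close>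

lemma not_ell1_embedding:
  assumes lin: "linear_between ell1 interp_space L"
    and emb: "embedding_map (norm_topology ell1) (norm_topology interp_space) L"
  shows False
proof -
  obtain c C where c: "0 < c"
    and lower: "\<And>a. a \<in> carrier ell1 \<Longrightarrow> c * vnorm ell1 a \<le> interp_norm (L a)"
    and upper: "\<And>a. a \<in> carrier ell1 \<Longrightarrow> interp_norm (L a) \<le> C * vnorm ell1 a"
    using linear_embedding_bounds[OF ell1_Normed_space interp_normed_space lin emb]
    unfolding interp_space_simps by metis
  have L: "L a \<in> interp_carrier" if "a \<in> carrier ell1" for a
    using lin that by (auto simp: linear_between_def interp_space_simps)
  have unit: "unit_seq i \<in> carrier ell1" "vnorm ell1 (unit_seq i) = 1" for i
    using finite_support_ell1[of "Suc i" "unit_seq i"] by (auto simp: unit_seq_def)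
  have tail: "\<exists>a M. m \<le> M \<and> (\<forall>i. i < m \<or> M \<le> i \<longrightarrow> a i = 0) \<and> (\<Sum>i<M. \<bar>a i\<bar>) = 1 \<and> supn (L a) \<le> d"
    if d: "0 < d" for m and d :: real
  proof -
    have "\<exists>N \<epsilon>. 0 < N \<and> (\<forall>i::nat. \<bar>\<epsilon> i\<bar> = 1) \<and>
        (\<forall>x. \<bar>\<Sum>i<N. \<epsilon> i * L (unit_seq (m + i)) x\<bar> \<le> d * real N)"
      using L unit upper[OF unit(1)] d by (intro small_signed_sum[where C = C]) auto
    then obtain N \<epsilon> where N: "0 < N" and eps: "\<forall>i::nat. \<bar>\<epsilon> i\<bar> = 1"
      and small: "\<forall>x. \<bar>\<Sum>i<N. \<epsilon> i * L (unit_seq (m + i)) x\<bar> \<le> d * real N"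
      by (elim exE conjE)
    \<comment> \<open>Division by \<open>N\<close> gives the block norm 1 in l_1 and turns the bound
      d N for the image into d.\<close>
    define a where "a i = (if m \<le> i \<and> i < m + N then \<epsilon> (i - m) / real N else 0)" for i
    have "L a = (\<lambda>x. \<Sum>i<m + N. a i * L (unit_seq i) x)"
      by (rule linear_finite_support[OF lin]) (simp add: a_def)
    then have "L a x = (\<Sum>i<N. \<epsilon> i * L (unit_seq (m + i)) x) / real N" for x
      by (simp add: sum_lessThan_add a_def sum_divide_distrib)
    then have "\<bar>L a x\<bar> \<le> d" for x
      using small N by (simp add: pos_divide_le_eq)
    then have "supn (L a) \<le> d" by (rule supn_le)
    moreover have "(\<Sum>i<m + N. \<bar>a i\<bar>) = 1"
      using N eps by (simp add: sum_lessThan_add a_def)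
    ultimately show ?thesis
      by (intro exI[of _ a] exI[of _ "m + N"]) (auto simp: a_def)
  qed
  \<comment> \<open>The bound does not grow with \<open>R\<close>: at each scale at most one block
    contributes as much as C, and all the others share s. Halving s in the induction makes room for
    the next block.\<close>
  have hump: "\<exists>a M. (\<forall>i\<ge>M. a i = 0) \<and> (\<Sum>i<M. \<bar>a i\<bar>) = real R \<and> interp_norm (L a) \<le> \<bar>C\<bar> + s"
    if "0 < s" for R s
    using that
  proof (induction R arbitrary: s)
    case 0
    have "(\<lambda>_. 0) \<in> carrier ell1" "vnorm ell1 (\<lambda>_. 0) = 0"
      using finite_support_ell1[of 0 "\<lambda>_. 0"] by auto
    with upper[of "\<lambda>_. 0"] 0 show ?case by (intro exI[of _ "\<lambda>_. 0"] exI[of _ 0]) auto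
  next
    case (Suc R)
    obtain a M where a: "\<forall>i\<ge>M. a i = 0" "(\<Sum>i<M. \<bar>a i\<bar>) = real R"
      "interp_norm (L a) \<le> \<bar>C\<bar> + s / 2"
      using Suc.IH[of "s / 2"] Suc.prems by auto
    have a_mem: "a \<in> carrier ell1" using finite_support_ell1(1) a(1) by blast
    obtain n0 where n0: "\<And>n. n \<ge> n0 \<Longrightarrow> K (2 ^ n) (L a) < s / 2"
    proof -
      have "\<forall>\<^sub>F n in sequentially. K (2 ^ n) (L a) < s / 2"
        by (rule order_tendstoD(2)[OF interp_K_tendsto[OF L[OF a_mem]]]) (use Suc.prems in simp)
      then show thesis using that by (auto simp: eventually_sequentially)
    qed
    \<comment> \<open>The new block is chosen after \<open>n0\<close>: at the scales below
      \<open>n0\<close> the supremum norm is amplified by at most \<open>2 ^ n0\<close>, so the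
      block contributes at most s / 2 there.\<close>
    obtain b M' where M': "M \<le> M'" and b: "\<forall>i. i < M \<or> M' \<le> i \<longrightarrow> b i = 0"
      "(\<Sum>i<M'. \<bar>b i\<bar>) = 1" "supn (L b) \<le> s / 2 / 2 ^ n0"
      using tail[of "s / 2 / 2 ^ n0" M] Suc.prems by auto
    have b0: "\<And>i. M' \<le> i \<Longrightarrow> b i = 0" using b(1) by blast
    have b_mem: "b \<in> carrier ell1" and b_norm: "vnorm ell1 b = 1"
      using finite_support_ell1[OF b0] b(2) by auto
    define d where "d = (\<lambda>i. a i + b i)"
    have "L (a \<oplus>\<^bsub>ell1\<^esub> b) = L a \<oplus>\<^bsub>interp_space\<^esub> L b"
      using lin a_mem b_mem unfolding linear_between_def by blast
    then have L_d: "L d = (\<lambda>x. L a x + L b x)"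
      by (simp add: ell1_simps interp_space_simps d_def)
    have "K (2 ^ n) (L d) \<le> \<bar>C\<bar> + s" for n
    proof -
      have add: "K (2 ^ n) (L d) \<le> K (2 ^ n) (L a) + K (2 ^ n) (L b)"
        unfolding L_d by (intro K_add_le interp_bounded L a_mem b_mem) simp
      show ?thesis
      proof (cases "n0 \<le> n")
        case True
        have "K (2 ^ n) (L b) \<le> C"
          using K_le_interp_norm[OF L[OF b_mem], of n] upper[OF b_mem] b_norm by simp
        then show ?thesis using add n0[OF True] Suc.prems by linarith
      next
        case False
        have "K (2 ^ n) (L b) \<le> 2 ^ n * supn (L b)"
          by (intro K_le_supn interp_bounded L b_mem) simp
        also have "\<dots> \<le> 2 ^ n0 * (s / 2 / 2 ^ n0)"
          using False b(3) supn_nonneg[OF interp_bounded[OF L[OF b_mem]]]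
          by (intro mult_mono power_increasing) auto
        also have "\<dots> = s / 2" by simp
        finally show ?thesis
          using add K_le_interp_norm[OF L[OF a_mem], of n] a(3) by linarith
      qed
    qed
    then have "interp_norm (L d) \<le> \<bar>C\<bar> + s" by (rule interp_norm_le)
    moreover have "\<forall>i\<ge>M'. d i = 0" using a(1) b0 M' by (simp add: d_def)
    moreover have "(\<Sum>i<M'. \<bar>d i\<bar>) = real (Suc R)"
    proof -
      have "\<bar>d i\<bar> = \<bar>a i\<bar> + \<bar>b i\<bar>" for i
        using a(1) b(1) by (cases "i < M") (auto simp: d_def)
      moreover have "(\<Sum>i<M'. \<bar>a i\<bar>) = (\<Sum>i<M. \<bar>a i\<bar>)"
        using a(1) M' by (intro sum.mono_neutral_right) auto
      ultimately show ?thesis using a(2) b(2) by (simp add: sum.distrib)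
    qed
    ultimately show ?case by blast
  qed
  obtain R :: nat where R: "(\<bar>C\<bar> + 1) / c < real R" using reals_Archimedean2 by blast
  obtain a M where a: "\<forall>i\<ge>M. a i = 0" "(\<Sum>i<M. \<bar>a i\<bar>) = real R" "interp_norm (L a) \<le> \<bar>C\<bar> + 1"
    using hump[of 1 R] by auto
  have "a \<in> carrier ell1" "vnorm ell1 a = real R"
    using finite_support_ell1[of M a] a by auto
  then have "c * real R \<le> \<bar>C\<bar> + 1" using lower[of a] a(3) by simp
  then show False using R c by (simp add: field_simps)
qed

lemma interp_Rosenthal_space: "Rosenthal_space interp_space"
  unfolding Rosenthal_space_def using interp_Banach_space not_ell1_embedding by blast

end


section \<open>The isometric action and the representation\<close>

lemma continuous_action_slice:
  assumes "topological_group G T" "continuous_action G T Y \<phi>" "g \<in> carrier G"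
  shows "continuous_map Y Y (\<phi> g)"
proof -
  have "continuous_map Y (prod_topology T Y) (\<lambda>x. (g, x))"
    using assms by (simp add: continuous_map_pairwise o_def topological_group_def)
  moreover have "continuous_map (prod_topology T Y) Y (\<lambda>(g, x). \<phi> g x)"
    using assms by (simp add: continuous_action_def)
  ultimately have "continuous_map Y Y ((\<lambda>(g, x). \<phi> g x) \<circ> (\<lambda>x. (g, x)))"
    by (rule continuous_map_compose)
  then show ?thesis by (simp add: o_def)
qed

lemma exponential_beats_linear: "\<exists>N. N * c + 1 < 2 ^ N" for c :: nat
proof -
  have "(\<lambda>N. real N * (1 / 2) ^ N) \<longlonglongrightarrow> 0"
    by (rule powser_times_n_limit_0) simp
  then have "(\<lambda>N. real N * (1 / 2) ^ N * real c + (1 / 2) ^ N) \<longlonglongrightarrow> 0 * real c + 0"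
    by (intro tendsto_intros LIMSEQ_power_zero) auto
  then have "\<forall>\<^sub>F N in sequentially. real N * (1 / 2) ^ N * real c + (1 / 2) ^ N < 1"
    by (intro order_tendstoD(2)) auto
  then obtain N where "real N * (1 / 2) ^ N * real c + (1 / 2) ^ N < 1"
    by (meson eventually_sequentially order_refl)
  then have "real N * real c + 1 < 2 ^ N"
    by (simp add: power_one_over field_simps)
  then have "real (N * c + 1) < real (2 ^ N)" by simp
  then show ?thesis by (meson of_nat_less_iff)
qed

locale noncrossing_system = noncrossing_family Y F for Y :: "'a topology" and F +
  fixes G :: "('g, 'm) monoid_scheme" and T :: "'g topology" and \<phi> :: "'g \<Rightarrow> 'a \<Rightarrow> 'a"
  assumes topological_group: "topological_group G T"
    and continuous_action: "continuous_action G T Y \<phi>"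
    and F_invariant: "f \<in> F \<Longrightarrow> g \<in> carrier G \<Longrightarrow>
      (\<lambda>x. if x \<in> topspace Y then f (\<phi> g x) else 0) \<in> F"
begin

definition translate :: "'g \<Rightarrow> ('a \<Rightarrow> real) \<Rightarrow> 'a \<Rightarrow> real" where
  "translate g f = (\<lambda>x. if x \<in> topspace Y then f (\<phi> g x) else 0)"

lemma translate_F: "f \<in> F \<Longrightarrow> g \<in> carrier G \<Longrightarrow> translate g f \<in> F"
  unfolding translate_def by (rule F_invariant)

lemma translate_linear:
  "translate g (\<lambda>x. f x + f' x) = (\<lambda>x. translate g f x + translate g f' x)"
  "translate g (\<lambda>x. f x - f' x) = (\<lambda>x. translate g f x - translate g f' x)"
  "translate g (\<lambda>x. c * f x) = (\<lambda>x. c * translate g f x)"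
  by (auto simp: translate_def)

lemma group_G: "group G"
  using topological_group by (simp add: topological_group_def)

lemma topspace_T: "topspace T = carrier G"
  using topological_group by (simp add: topological_group_def)

lemma action: "group_action G (topspace Y) \<phi>"
  using continuous_action by (simp add: continuous_action_def)

lemma action_mem: "g \<in> carrier G \<Longrightarrow> x \<in> topspace Y \<Longrightarrow> \<phi> g x \<in> topspace Y"
  using group_action.element_image[OF action] by blast

lemma action_mult: "g \<in> carrier G \<Longrightarrow> h \<in> carrier G \<Longrightarrow> x \<in> topspace Y \<Longrightarrow>
    \<phi> (g \<otimes>\<^bsub>G\<^esub> h) x = \<phi> g (\<phi> h x)"
  using group_action.composition_rule[OF action] by blast

lemma action_one: "x \<in> topspace Y \<Longrightarrow> \<phi> \<one>\<^bsub>G\<^esub> x = x"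
  using group_action.id_eq_one[OF action] by (metis restrict_apply')

lemma action_continuous: "continuous_map (prod_topology T Y) Y (\<lambda>(g, x). \<phi> g x)"
  using continuous_action by (simp add: continuous_action_def)

lemma action_continuous_slice: "g \<in> carrier G \<Longrightarrow> continuous_map Y Y (\<phi> g)"
  using continuous_action_slice[OF topological_group continuous_action] .

text \<open>Precomposition reverses the order of the factors; this becomes the co-homomorphism law
  for \<open>rep\<close>.\<close>

lemma translate_mult:
  assumes "g \<in> carrier G" "h \<in> carrier G"
  shows "translate (g \<otimes>\<^bsub>G\<^esub> h) f = translate h (translate g f)"
  using assms by (auto simp: translate_def action_mult action_mem)

lemma translate_inverse:
  assumes "g \<in> carrier G" "\<And>x. x \<notin> topspace Y \<Longrightarrow> f x = 0"
  shows "translate (inv\<^bsub>G\<^esub> g) (translate g f) = f"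
proof -
  interpret group G by (rule group_G)
  have "translate (inv\<^bsub>G\<^esub> g) (translate g f) = translate \<one>\<^bsub>G\<^esub> f"
    using assms(1) by (simp flip: translate_mult)
  then show ?thesis using assms(2) by (auto simp: translate_def action_one)
qed

lemma translate_bounded: "bounded (range f) \<Longrightarrow> bounded (range (translate g f))"
  by (rule bounded_subset[of "insert 0 (range f)"]) (auto simp: translate_def)

lemma translate_supn_le:
  assumes "bounded (range f)"
  shows "supn (translate g f) \<le> supn f"
  by (rule supn_le) (use assms in \<open>auto simp: translate_def abs_le_supn supn_nonneg\<close>)

lemma translate_hull:
  assumes "g \<in> carrier G"
  shows "w \<in> abs_hull F \<Longrightarrow> translate g w \<in> abs_hull F"
proof (induction rule: abs_hull.induct)
  case zero
  then show ?case using abs_hull.zero by (simp add: translate_def)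
next
  case (base f)
  then show ?case by (intro abs_hull.base translate_F assms)
next
  case (uminus f)
  then show ?case
    using abs_hull.uminus[OF translate_F[OF uminus assms]] translate_linear(3)[of g "-1" f] by simp
next
  case (convex u v l)
  then show ?case by (simp add: translate_linear abs_hull.convex)
qed

text \<open>Translation maps the hull into itself and does not increase the supremum norm, so it
  carries decompositions to decompositions. For the norm, \<open>translate_norm\<close> obtains
  equality from the inverse element.\<close>

lemma K_translate_le:
  assumes "bounded (range f)" "0 < q" "g \<in> carrier G"
  shows "K q (translate g f) \<le> K q f"
proof (rule K_ge)
  fix t w assume t: "0 \<le> (t::real)" "w \<in> abs_hull F"
  have "K q (translate g f) \<le> t / q + q * supn (\<lambda>x. translate g f x - t * translate g w x)"
    by (intro K_le translate_bounded assms t translate_hull)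
  also have "supn (\<lambda>x. translate g f x - t * translate g w x) \<le> supn (\<lambda>x. f x - t * w x)"
    using translate_supn_le[OF hull_residual_bounded[OF assms(1) t(2), of t], of g]
    by (simp add: translate_linear)
  finally show "K q (translate g f) \<le> t / q + q * supn (\<lambda>x. f x - t * w x)"
    using assms(2) by simp
qed

lemma translate_interp:
  assumes "f \<in> interp_carrier" "g \<in> carrier G"
  shows "translate g f \<in> interp_carrier"
proof -
  have "continuous_map Y euclideanreal (f \<circ> \<phi> g)"
    using continuous_map_compose[OF action_continuous_slice interp_continuous] assms by blast
  then have "continuous_map Y euclideanreal (translate g f)"
    by (rule continuous_map_eq) (simp add: translate_def)
  moreover have "(\<lambda>n. K (2 ^ n) (translate g f)) \<longlonglongrightarrow> 0"
  proof (rule tendsto_sandwich[where f = "\<lambda>_. 0" and h = "\<lambda>n. K (2 ^ n) f"])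
    show "(\<lambda>n. K (2 ^ n) f) \<longlonglongrightarrow> 0" by (rule interp_K_tendsto[OF assms(1)])
  qed (use assms in \<open>auto intro!: always_eventually K_nonneg K_translate_le translate_bounded
      interp_bounded[OF assms(1)]\<close>)
  ultimately show ?thesis
    by (simp add: interp_carrier_def translate_def)
qed

lemma translate_norm_le:
  assumes "f \<in> interp_carrier" "g \<in> carrier G"
  shows "interp_norm (translate g f) \<le> interp_norm f"
proof (rule interp_norm_le)
  fix n
  have "K (2 ^ n) (translate g f) \<le> K (2 ^ n) f"
    by (intro K_translate_le interp_bounded assms) simp
  also have "\<dots> \<le> interp_norm f" by (rule K_le_interp_norm[OF assms(1)])
  finally show "K (2 ^ n) (translate g f) \<le> interp_norm f" .
qed

lemma translate_inverse_interp:
  "f \<in> interp_carrier \<Longrightarrow> g \<in> carrier G \<Longrightarrow> translate (inv\<^bsub>G\<^esub> g) (translate g f) = f"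
  by (intro translate_inverse interp_zero_outside)

lemma translate_norm:
  assumes "f \<in> interp_carrier" "g \<in> carrier G"
  shows "interp_norm (translate g f) = interp_norm f"
  using translate_norm_le[OF assms]
    translate_norm_le[OF translate_interp[OF assms] group.inv_closed[OF group_G assms(2)]]
  by (simp add: translate_inverse_interp[OF assms])

section \<open>The isometries and their strong continuity\<close>

definition rep :: "'g \<Rightarrow> ('a \<Rightarrow> real) \<Rightarrow> 'a \<Rightarrow> real" where
  "rep g = restrict (translate g) interp_carrier"

lemma rep_isometry:
  assumes g: "g \<in> carrier G"
  shows "rep g \<in> isometries interp_space"
proof -
  interpret group G by (rule group_G)
  have "translate g ` interp_carrier = interp_carrier"
  proof
    show "translate g ` interp_carrier \<subseteq> interp_carrier" using translate_interp g by blast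
    show "interp_carrier \<subseteq> translate g ` interp_carrier"
    proof
      fix f assume f: "f \<in> interp_carrier"
      have "translate (inv\<^bsub>G\<^esub> (inv\<^bsub>G\<^esub> g)) (translate (inv\<^bsub>G\<^esub> g) f) = f"
        using f g by (intro translate_inverse_interp) auto
      then have "f = translate g (translate (inv\<^bsub>G\<^esub> g) f)" using g by simp
      then show "f \<in> translate g ` interp_carrier" using f g translate_interp inv_closed by blast
    qed
  qed
  then show ?thesis
    using g by (auto simp: isometries_def linear_between_def interp_space_simps rep_def
        translate_interp translate_norm translate_linear interp_add interp_mult)
qed

text \<open>Compactness of \<open>Y\<close>: the tube lemma makes the joint continuity of the action
  uniform in x.\<close>

lemma translate_supn_continuous:
  assumes f: "continuous_map Y euclideanreal f" and g: "g \<in> carrier G" and e: "0 < e"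
  obtains U where "openin T U" "g \<in> U"
    "\<And>h. h \<in> U \<Longrightarrow> supn (\<lambda>x. translate h f x - translate g f x) \<le> e"
proof -
  define d where "d p = f (\<phi> (fst p) (snd p)) - f (\<phi> g (snd p))" for p
  have "continuous_map (prod_topology T Y) euclideanreal (\<lambda>p. f (\<phi> (fst p) (snd p)))"
    using continuous_map_compose[OF action_continuous f] by (simp add: o_def case_prod_unfold)
  moreover have "continuous_map (prod_topology T Y) euclideanreal (\<lambda>p. f (\<phi> g (snd p)))"
    using continuous_map_compose[OF continuous_map_snd
        continuous_map_compose[OF action_continuous_slice[OF g] f], of T]
    by (simp add: o_def)
  ultimately have "continuous_map (prod_topology T Y) euclideanreal d"
    unfolding d_def by (rule continuous_map_diff)
  from openin_continuous_map_preimage[OF this, of "{- e<..<e}"]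
  have 1: "openin (prod_topology T Y) {p \<in> topspace (prod_topology T Y). d p \<in> {- e<..<e}}"
    by simp
  have 2: "compactin Y (topspace Y)" using compact by (simp add: compact_space_def)
  have 3: "{g} \<times> topspace Y \<subseteq> {p \<in> topspace (prod_topology T Y). d p \<in> {- e<..<e}}"
    using g e by (auto simp: d_def topspace_T)
  have 4: "g \<in> topspace T" using g by (simp add: topspace_T)
  obtain U V where U: "openin T U" "g \<in> U" "topspace Y \<subseteq> V"
    "U \<times> V \<subseteq> {p \<in> topspace (prod_topology T Y). d p \<in> {- e<..<e}}"
    using tube_lemma_right[OF 1 2 4 3] by (elim exE conjE)
  show thesis
  proof (rule that[OF U(1,2)])
    fix h assume h: "h \<in> U"
    show "supn (\<lambda>x. translate h f x - translate g f x) \<le> e"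
    proof (rule supn_le)
      fix x show "\<bar>translate h f x - translate g f x\<bar> \<le> e"
      proof (cases "x \<in> topspace Y")
        case True
        then have "(h, x) \<in> U \<times> V" using h U by blast
        then have "d (h, x) \<in> {- e<..<e}" using U(4) by blast
        then show ?thesis using True by (simp add: d_def translate_def abs_le_iff)
      qed (use e in \<open>simp add: translate_def\<close>)
    qed
  qed
qed

text \<open>At the scales from \<open>n0\<close> on, translates have K-values no larger than those
  of f, hence small for every group element. At the finitely many lower scales the K-functional is
  at most \<open>2 ^ n0\<close> times the supremum norm, in which translation is continuous.\<close>

lemma rep_strongly_continuous:
  assumes f: "f \<in> interp_carrier"
  shows "continuous_map T interp.mtopology (\<lambda>g. translate g f)"
  unfolding interp.continuous_map_to_metric
proof (intro ballI allI impI)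
  fix g and e :: real assume "g \<in> topspace T" and e: "0 < e"
  then have g: "g \<in> carrier G" by (simp add: topspace_T)
  have "\<forall>\<^sub>F n in sequentially. K (2 ^ n) f < e / 4"
    by (rule order_tendstoD(2)[OF interp_K_tendsto[OF f]]) (use e in simp)
  then obtain n0 where n0: "\<And>n. n \<ge> n0 \<Longrightarrow> K (2 ^ n) f < e / 4"
    by (auto simp: eventually_sequentially)
  obtain U where U: "openin T U" "g \<in> U"
    "\<And>h. h \<in> U \<Longrightarrow> supn (\<lambda>x. translate h f x - translate g f x) \<le> e / 2 / 2 ^ n0"
    using translate_supn_continuous[OF interp_continuous[OF f] g, of "e / 2 / 2 ^ n0"] e by auto
  have "translate h f \<in> interp.mball (translate g f) e" if h: "h \<in> U" for h
  proof -
    have hG: "h \<in> carrier G" using h U openin_subset topspace_T by blast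
    have bdd: "bounded (range (translate k f))" for k
      by (intro translate_bounded interp_bounded f)
    have "interp_norm (\<lambda>x. translate h f x - translate g f x) \<le> e / 2"
    proof (rule interp_norm_le)
      fix n
      show "K (2 ^ n) (\<lambda>x. translate h f x - translate g f x) \<le> e / 2"
      proof (cases "n0 \<le> n")
        case True
        have "K (2 ^ n) (\<lambda>x. translate h f x - translate g f x) \<le>
            K (2 ^ n) (translate h f) + K (2 ^ n) (translate g f)"
          by (intro K_diff_le bdd) simp
        also have "\<dots> \<le> K (2 ^ n) f + K (2 ^ n) f"
          by (intro add_mono K_translate_le interp_bounded f g hG) auto
        also have "\<dots> \<le> e / 2" using n0[OF True] by simp
        finally show ?thesis .
      next
        case False
        have "K (2 ^ n) (\<lambda>x. translate h f x - translate g f x) \<le>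
            2 ^ n * supn (\<lambda>x. translate h f x - translate g f x)"
          by (intro K_le_supn bounded_range_diff bdd) simp
        also have "\<dots> \<le> 2 ^ n0 * (e / 2 / 2 ^ n0)"
          using False U(3)[OF h] supn_nonneg[OF bounded_range_diff[OF bdd bdd]]
          by (intro mult_mono power_increasing) auto
        also have "\<dots> = e / 2" by simp
        finally show ?thesis .
      qed
    qed
    then have "vdist interp_space (translate h f) (translate g f) < e"
      using e by (simp add: vdist_interp translate_interp f g hG)
    then show ?thesis
      by (simp add: interp.mball_def translate_interp f g hG interp.commute)
  qed
  then show "\<exists>U. openin T U \<and> g \<in> U \<and> (\<forall>h\<in>U. translate h f \<in> interp.mball (translate g f) e)"
    using U by blast
qed

section \<open>The embedding into the dual\<close>

definition evaluation :: "'a \<Rightarrow> ('a \<Rightarrow> real) \<Rightarrow> real" where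
  "evaluation x = restrict (\<lambda>f. f x) interp_carrier"

lemma evaluation_dual: "evaluation x \<in> dual_space interp_space"
proof -
  have "\<forall>f\<in>interp_carrier. \<bar>evaluation x f\<bar> \<le> 1 * interp_norm f"
    by (simp add: evaluation_def abs_le_interp_norm)
  then show ?thesis
    unfolding dual_space_def interp_space_simps mem_Collect_eq
    by (intro conjI exI[of _ 1]) (auto simp: evaluation_def interp_add interp_mult)
qed

lemma evaluation_continuous: "continuous_map Y (weak_star_topology interp_space) evaluation"
  unfolding weak_star_topology_def interp_space_simps continuous_map_in_subtopology
proof (intro conjI continuous_map_componentwise[THEN iffD2] ballI)
  fix f assume f: "f \<in> interp_carrier"
  show "continuous_map Y euclideanreal (\<lambda>x. evaluation x f)"
    using interp_continuous[OF f] f by (simp add: evaluation_def)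
qed (use evaluation_dual in \<open>auto simp: evaluation_def interp_space_simps\<close>)

lemma evaluation_embedding: "embedding_map Y (weak_star_topology interp_space) evaluation"
proof (rule continuous_imp_embedding_map[OF evaluation_continuous compact])
  show "Hausdorff_space (weak_star_topology interp_space)"
    unfolding weak_star_topology_def
    by (intro Hausdorff_space_subtopology) (simp add: Hausdorff_space_product_topology)
  show "inj_on evaluation (topspace Y)"
  proof (rule inj_onI, rule ccontr)
    fix x y assume xy: "x \<in> topspace Y" "y \<in> topspace Y" "evaluation x = evaluation y" "x \<noteq> y"
    then obtain f where f: "f \<in> F" "f x \<noteq> f y" using F_separates by blast
    then have "f \<in> interp_carrier" using F_subset_interp by blast
    then show False using fun_cong[OF xy(3), of f] f(2) by (simp add: evaluation_def)
  qed
qed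

lemma evaluation_representation: "representation G T Y \<phi> interp_space rep evaluation"
  unfolding representation_def
proof (intro conjI ballI)
  show "continuous_map T (strong_operator_topology interp_space) rep"
    unfolding strong_operator_topology_def continuous_map_in_subtopology interp_space_simps
  proof (intro conjI continuous_map_componentwise[THEN iffD2] ballI)
    fix f assume "f \<in> interp_carrier"
    then show "continuous_map T (norm_topology interp_space) (\<lambda>g. rep g f)"
      using rep_strongly_continuous by (simp add: norm_topology_def interp_space_simps rep_def)
  qed (use rep_isometry topspace_T in \<open>auto simp: rep_def\<close>)
next
  fix g h assume "g \<in> carrier G" "h \<in> carrier G"
  then show "rep (g \<otimes>\<^bsub>G\<^esub> h) = compose (carrier interp_space) (rep h) (rep g)"
    by (auto simp: rep_def compose_def interp_space_simps translate_mult translate_interp)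
next
  show "continuous_map Y (weak_star_topology interp_space) evaluation"
    by (rule evaluation_continuous)
next
  have "dual_norm interp_space (evaluation x) \<le> 1" for x
    unfolding dual_norm_def
  proof (rule cSUP_least)
    show "{f \<in> carrier interp_space. vnorm interp_space f \<le> 1} \<noteq> {}"
      using interp_zero interp_norm_mult[OF interp_zero, of 0] by (auto simp: interp_space_simps)
    fix f assume "f \<in> {f \<in> carrier interp_space. vnorm interp_space f \<le> 1}"
    then have f: "f \<in> interp_carrier" "interp_norm f \<le> 1" by (auto simp: interp_space_simps)
    then show "\<bar>evaluation x f\<bar> \<le> 1"
      using abs_le_interp_norm[OF f(1), of x] by (simp add: evaluation_def)
  qed
  then show "\<exists>C. \<forall>x\<in>topspace Y. dual_norm interp_space (evaluation x) \<le> C" by blast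
next
  fix f g x assume "f \<in> carrier interp_space" "g \<in> carrier G" "x \<in> topspace Y"
  then show "evaluation (\<phi> g x) f = evaluation x (rep g f)"
    by (simp add: evaluation_def rep_def interp_space_simps translate_interp) (simp add: translate_def)
qed


section \<open>Tameness\<close>

text \<open>The pairs on which f differs by at least e form a compact set off the diagonal. It is
  covered by open sets of pairs that one member of \<open>F\<close> pushes apart by more than a
  positive amount, and a finite subcover yields \<open>H\<close> and \<open>d\<close>.\<close>

lemma F_controls:
  assumes f: "continuous_map Y euclideanreal f" and e: "0 < e"
  obtains H d where "finite H" "H \<subseteq> F" "0 < d"
    "\<And>x y. x \<in> topspace Y \<Longrightarrow> y \<in> topspace Y \<Longrightarrow> (\<And>h. h \<in> H \<Longrightarrow> \<bar>h x - h y\<bar> \<le> d) \<Longrightarrow>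
      \<bar>f x - f y\<bar> < e"
proof -
  have cont: "continuous_map (prod_topology Y Y) euclideanreal (\<lambda>p. \<bar>h (fst p) - h (snd p)\<bar>)"
    if h: "continuous_map Y euclideanreal h" for h
    using continuous_map_compose[OF continuous_map_fst h, of Y]
      continuous_map_compose[OF continuous_map_snd h, of Y]
    by (intro continuous_map_real_abs continuous_map_diff) (simp_all add: o_def)
  define A where "A = {p \<in> topspace (prod_topology Y Y). \<bar>f (fst p) - f (snd p)\<bar> \<in> {e..}}"
  define apart where "apart q = {p \<in> topspace (prod_topology Y Y).
      \<bar>fst q (fst p) - fst q (snd p)\<bar> \<in> {snd q<..}}" for q :: "('a \<Rightarrow> real) \<times> real"
  have "closedin (prod_topology Y Y) A"
    unfolding A_def by (rule closedin_continuous_map_preimage[OF cont[OF f]]) simp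
  moreover have "compact_space (prod_topology Y Y)"
    using compact by (simp add: compact_space_prod_topology)
  ultimately have A: "compactin (prod_topology Y Y) A" by (simp add: closedin_compact_space)
  have apart_open: "openin (prod_topology Y Y) (apart q)" if "q \<in> F \<times> {0<..}" for q
    unfolding apart_def using that
    by (intro openin_continuous_map_preimage[OF cont[OF F_continuous]]) auto
  have cover: "A \<subseteq> \<Union> (apart ` (F \<times> {0<..}))"
  proof
    fix p assume p: "p \<in> A"
    obtain x y where xy: "p = (x, y)" by (cases p)
    have "x \<in> topspace Y" "y \<in> topspace Y" "x \<noteq> y" using p e by (auto simp: A_def xy)
    then obtain h where h: "h \<in> F" "h x \<noteq> h y" using F_separates by blast
    then have "p \<in> apart (h, \<bar>h x - h y\<bar> / 2)"
      using p by (simp add: apart_def A_def xy)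
    then show "p \<in> \<Union> (apart ` (F \<times> {0<..}))" using h by force
  qed
  obtain \<U> where U: "finite \<U>" "\<U> \<subseteq> apart ` (F \<times> {0<..})" "A \<subseteq> \<Union>\<U>"
    using compactinD[OF A _ cover] apart_open by blast
  obtain Q where Q: "finite Q" "Q \<subseteq> F \<times> {0<..}" "\<U> = apart ` Q"
    using finite_subset_image[OF U(1,2)] by blast
  \<comment> \<open>The 1 keeps the minimum defined when no pair has to be covered.\<close>
  define d where "d = Min (insert 1 (snd ` Q))"
  have d: "d \<le> snd q" if "q \<in> Q" for q
    using that Q(1) by (simp add: d_def)
  show thesis
  proof (rule that[of "fst ` Q" d])
    show "0 < d" using Q by (auto simp: d_def)
    show "fst ` Q \<subseteq> F" "finite (fst ` Q)" using Q by auto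
    fix x y assume xy: "x \<in> topspace Y" "y \<in> topspace Y"
      and small: "\<And>h. h \<in> fst ` Q \<Longrightarrow> \<bar>h x - h y\<bar> \<le> d"
    show "\<bar>f x - f y\<bar> < e"
    proof (rule ccontr)
      assume "\<not> \<bar>f x - f y\<bar> < e"
      then have "(x, y) \<in> A" using xy by (simp add: A_def)
      then obtain q where q: "q \<in> Q" "(x, y) \<in> apart q" using U(3) Q(3) by blast
      then have "snd q < \<bar>fst q x - fst q y\<bar>" by (simp add: apart_def)
      then show False using small[of "fst q"] d[OF q(1)] q(1) by fastforce
    qed
  qed
qed

text \<open>
  Independence of N translates of f produces as many different patterns as there are subsets of N
  points, whereas the finitely many functions that control f produce only linearly many.
\<close>

lemma tame: "tame_system G Y \<phi>"
  unfolding tame_system_def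
proof (intro allI impI notI, elim exE conjE)
  fix f and f' :: "nat \<Rightarrow> 'a \<Rightarrow> real"
  assume f: "continuous_map Y euclideanreal f"
    and range: "range f' \<subseteq> (\<lambda>g x. f (\<phi> g x)) ` carrier G"
    and indep: "independent_sequence (topspace Y) f'"
  obtain g where g: "\<And>n. g n \<in> carrier G" "\<And>n. f' n = (\<lambda>x. f (\<phi> (g n) x))"
  proof -
    have "\<forall>n. \<exists>g. g \<in> carrier G \<and> f' n = (\<lambda>x. f (\<phi> g x))" using range by blast
    then show thesis using that by metis
  qed
  obtain a b where ab: "a < b"
    and ind: "\<forall>P M. finite P \<and> finite M \<and> P \<inter> M = {} \<longrightarrow>
        {x \<in> topspace Y. (\<forall>n\<in>P. f' n x < a) \<and> (\<forall>n\<in>M. b < f' n x)} \<noteq> {}"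
    using indep unfolding independent_sequence_def by (elim exE conjE)
  obtain H d where H: "finite H" "H \<subseteq> F" "0 < d"
    and control: "\<And>x y. x \<in> topspace Y \<Longrightarrow> y \<in> topspace Y \<Longrightarrow> (\<And>h. h \<in> H \<Longrightarrow> \<bar>h x - h y\<bar> \<le> d) \<Longrightarrow>
      \<bar>f x - f y\<bar> < b - a"
    using F_controls[OF f, of "b - a"] ab by auto
  \<comment> \<open>Two points that share a net point differ by at most 2 / M in each controlling
    function, and this must not exceed d.\<close>
  obtain m where m: "1 / real (Suc m) < d / 2"
    using nat_approx_posE[of "d / 2"] H(3) by auto
  define M where "M = Suc m"
  obtain N where N: "N * (card H * M) + 1 < 2 ^ N" using exponential_beats_linear by blast
  obtain Z where Z: "Z \<subseteq> topspace Y" "finite Z" "card Z \<le> card ({..<N} \<times> H) * M + 1"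
    "\<And>x. x \<in> topspace Y \<Longrightarrow> \<exists>y\<in>Z. \<forall>p\<in>{..<N} \<times> H.
      \<bar>translate (g (fst p)) (snd p) x - translate (g (fst p)) (snd p) y\<bar> \<le> 1 / real M"
  proof (rule F_net[of "{..<N} \<times> H" "\<lambda>p. translate (g (fst p)) (snd p)" M])
    show "0 < M" by (simp add: M_def)
  qed (use H g translate_F in auto)
  have "\<exists>x\<in>topspace Y. (\<forall>n\<in>S. f' n x < a) \<and> (\<forall>n\<in>{..<N} - S. b < f' n x)" if "S \<subseteq> {..<N}" for S
  proof -
    have "finite S \<and> finite ({..<N} - S) \<and> S \<inter> ({..<N} - S) = {}"
      using finite_subset[OF that] by auto
    then have "{x \<in> topspace Y. (\<forall>n\<in>S. f' n x < a) \<and> (\<forall>n\<in>{..<N} - S. b < f' n x)} \<noteq> {}"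
      using ind by presburger
    then show ?thesis by blast
  qed
  then obtain x where x: "\<And>S. S \<subseteq> {..<N} \<Longrightarrow> x S \<in> topspace Y"
    "\<And>S n. S \<subseteq> {..<N} \<Longrightarrow> n \<in> S \<Longrightarrow> f' n (x S) < a"
    "\<And>S n. S \<subseteq> {..<N} \<Longrightarrow> n < N \<Longrightarrow> n \<notin> S \<Longrightarrow> b < f' n (x S)"
    by (metis DiffI lessThan_iff)
  have "\<exists>y\<in>Z. \<forall>n<N. \<forall>h\<in>H. \<bar>h (\<phi> (g n) (x S)) - h (\<phi> (g n) y)\<bar> \<le> 1 / real M"
    if S: "S \<subseteq> {..<N}" for S
  proof -
    obtain y where y: "y \<in> Z" "\<forall>p\<in>{..<N} \<times> H.
        \<bar>translate (g (fst p)) (snd p) (x S) - translate (g (fst p)) (snd p) y\<bar> \<le> 1 / real M"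
      using Z(4)[OF x(1)[OF S]] by blast
    moreover have "y \<in> topspace Y" using y Z by blast
    ultimately show ?thesis using x(1)[OF S] by (intro bexI[of _ y]) (auto simp: translate_def)
  qed
  then obtain y where y: "\<And>S. S \<subseteq> {..<N} \<Longrightarrow> y S \<in> Z"
    "\<And>S n h. S \<subseteq> {..<N} \<Longrightarrow> n < N \<Longrightarrow> h \<in> H \<Longrightarrow>
      \<bar>h (\<phi> (g n) (x S)) - h (\<phi> (g n) (y S))\<bar> \<le> 1 / real M"
    by metis
  \<comment> \<open>A shared net point forces equal patterns: an index in only one of the two sets
    would put its translate of f below a at one point and above b at the other, a gap that
    \<open>control\<close> forbids.\<close>
  have sub: "S \<subseteq> S'" if S: "S \<subseteq> {..<N}" "S' \<subseteq> {..<N}" "y S = y S'" for S S'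
  proof (rule ccontr)
    assume "\<not> S \<subseteq> S'"
    then obtain n where n: "n \<in> S" "n \<notin> S'" "n < N" using S by blast
    have "\<bar>f (\<phi> (g n) (x S)) - f (\<phi> (g n) (x S'))\<bar> < b - a"
    proof (rule control)
      fix h assume "h \<in> H"
      then show "\<bar>h (\<phi> (g n) (x S)) - h (\<phi> (g n) (x S'))\<bar> \<le> d"
        using y(2)[OF S(1) n(3)] y(2)[OF S(2) n(3)] m S(3) unfolding M_def by fastforce
    qed (use x S g action_mem in auto)
    moreover have "f' n (x S) < a" "b < f' n (x S')" using x n S by auto
    ultimately show False by (simp add: g(2))
  qed
  have "inj_on y (Pow {..<N})"
    using sub by (intro inj_onI) (metis PowD subset_antisym)
  moreover have "y ` Pow {..<N} \<subseteq> Z" using y(1) by blast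
  ultimately have "card (Pow {..<N}) \<le> card Z"
    using Z(2) by (metis card_image card_mono)
  then show False using Z(3) N by (simp add: card_Pow card_cartesian_product mult.assoc)
qed

end


section \<open>Cut points\<close>

text \<open>The two sides belong to the datum, because the complement of a point may have many
  components, which can be grouped in several ways.\<close>

definition cut_at :: "'a topology \<Rightarrow> 'a set \<Rightarrow> 'a \<Rightarrow> 'a set \<Rightarrow> bool" where
  "cut_at D U w V \<longleftrightarrow> w \<in> topspace D \<and> openin D U \<and> openin D V \<and> U \<inter> V = {} \<and>
     topspace D - {w} = U \<union> V"

lemma cut_commute: "cut_at D U w V \<Longrightarrow> cut_at D V w U"
  unfolding cut_at_def by blast

lemma cut_complement: "cut_at D U w V \<Longrightarrow> insert w V = topspace D - U"
  unfolding cut_at_def by blast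

text \<open>If \<open>insert w U\<close> fell apart into two relatively closed pieces, the piece
  without \<open>w\<close> would be clopen in \<open>D\<close>: its complement is the other piece
  together with the closed set \<open>insert w V\<close>.\<close>

lemma cut_connectedin:
  assumes conn: "connected_space D" and cut: "cut_at D U w V"
  shows "connectedin D (insert w U)"
proof -
  have closed: "closedin D (insert w U)" "closedin D (insert w V)"
    using cut cut_complement[OF cut] cut_complement[OF cut_commute[OF cut]]
    by (auto simp: cut_at_def)
  have no_split: False
    if E: "closedin D E1" "closedin D E2" "insert w U \<subseteq> E1 \<union> E2" "E1 \<inter> E2 \<inter> insert w U = {}"
      "w \<in> E1" "E2 \<inter> insert w U \<noteq> {}" for E1 E2
  proof -
    have "closedin D ((E1 \<inter> insert w U) \<union> insert w V)" "closedin D (E2 \<inter> insert w U)"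
      by (intro closedin_Un closedin_Int E closed)+
    moreover have "((E1 \<inter> insert w U) \<union> insert w V) \<union> (E2 \<inter> insert w U) = topspace D"
      using E cut unfolding cut_at_def by blast
    moreover have "((E1 \<inter> insert w U) \<union> insert w V) \<inter> (E2 \<inter> insert w U) = {}"
      using E cut unfolding cut_at_def by blast
    ultimately show False
      using conn E(6) unfolding connected_space_closedin_eq by blast
  qed
  show ?thesis
    unfolding connectedin_closedin
  proof (intro conjI notI)
    show "insert w U \<subseteq> topspace D" using closed closedin_subset by blast
    assume "\<exists>E1 E2. closedin D E1 \<and> closedin D E2 \<and> insert w U \<subseteq> E1 \<union> E2 \<and>
      E1 \<inter> E2 \<inter> insert w U = {} \<and> E1 \<inter> insert w U \<noteq> {} \<and> E2 \<inter> insert w U \<noteq> {}"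
    then obtain E1 E2 where E: "closedin D E1" "closedin D E2" "insert w U \<subseteq> E1 \<union> E2"
      "E1 \<inter> E2 \<inter> insert w U = {}" "E1 \<inter> insert w U \<noteq> {}" "E2 \<inter> insert w U \<noteq> {}"
      by (elim exE conjE)
    show False
    proof (cases "w \<in> E1")
      case True
      then show False using no_split[of E1 E2] E by blast
    next
      case False
      have "insert w U \<subseteq> E2 \<union> E1" "E2 \<inter> E1 \<inter> insert w U = {}" "w \<in> E2" using E False by blast+
      then show False using no_split[of E2 E1] E by blast
    qed
  qed
qed

lemma cut_one_side:
  assumes cut: "cut_at D U w V" and S: "connectedin D S" "w \<notin> S" "x \<in> S" "x \<in> U"
  shows "S \<subseteq> U"
proof (rule ccontr)
  assume "\<not> S \<subseteq> U"
  moreover have sub: "S \<subseteq> U \<union> V"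
    using connectedin_subset_topspace[OF S(1)] S(2) cut unfolding cut_at_def by blast
  ultimately have "V \<inter> S \<noteq> {}" "U \<inter> S \<noteq> {}" using S by blast+
  moreover have "U \<inter> V \<inter> S = {}" "openin D U" "openin D V" using cut unfolding cut_at_def by blast+
  ultimately show False using connectedinD[OF S(1) _ _ sub] by blast
qed

text \<open>The closed set \<open>insert w U\<close> plays the part of the closure of
  \<open>U\<close> in Urysohn's construction.\<close>

fun cut_below :: "'a topology \<Rightarrow> 'a set \<times> 'a \<times> 'a set \<Rightarrow> 'a set \<times> 'a \<times> 'a set \<Rightarrow> bool" where
  "cut_below D (U, w, V) (U', w', V') \<longleftrightarrow> cut_at D U w V \<and> cut_at D U' w' V' \<and> insert w U \<subseteq> U'"

lemma cut_below_dual: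
  assumes "cut_below D (U, w, V) (U', w', V')"
  shows "insert w' V' \<subseteq> V"
proof -
  have cuts: "cut_at D U w V" "cut_at D U' w' V'" "insert w U \<subseteq> U'" using assms by simp_all
  have "insert w' V' = topspace D - U'" by (rule cut_complement[OF cuts(2)])
  also have "\<dots> \<subseteq> topspace D - insert w U" using cuts(3) by blast
  also have "\<dots> \<subseteq> V" using cuts(1) unfolding cut_at_def by blast
  finally show ?thesis .
qed

lemma cut_below_trans: "cut_below D c c' \<Longrightarrow> cut_below D c' c'' \<Longrightarrow> cut_below D c c''"
  by (cases c; cases c'; cases c'') auto

section \<open>Density of cuts in a dendron\<close>

context
  fixes D :: "'a topology"
  assumes dendron: "dendron D"
begin

lemma dendron_connected: "connected_space D"
  using dendron by (simp add: dendron_def continuum_def)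

lemma dendron_cut:
  assumes "u \<in> topspace D" "v \<in> topspace D" "u \<noteq> v"
  obtains U w V where "cut_at D U w V" "u \<in> U" "v \<in> V"
proof -
  have "\<exists>w\<in>topspace D. \<exists>U V. openin D U \<and> openin D V \<and> U \<inter> V = {} \<and>
      topspace D - {w} = U \<union> V \<and> u \<in> U \<and> v \<in> V"
    using dendron assms by (simp add: dendron_def)
  then show thesis using that unfolding cut_at_def by blast
qed

lemma cut_connectedin_both:
  assumes "cut_at D U w V"
  shows "connectedin D (insert w U)" "connectedin D (insert w V)"
  using cut_connectedin[OF dendron_connected assms]
    cut_connectedin[OF dendron_connected cut_commute[OF assms]] by simp_all

text \<open>Any cut point \<open>x\<close> between \<open>w\<close> and \<open>w'\<close> will do.
  It lies outside \<open>U\<close>, as otherwise the connected set \<open>insert w V\<close>, which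
  contains both \<open>w\<close> and \<open>w'\<close>, would avoid \<open>x\<close>; symmetrically
  it lies outside \<open>V'\<close>.\<close>

lemma cut_below_dense:
  assumes "cut_below D c c'"
  shows "\<exists>d. cut_below D c d \<and> cut_below D d c'"
proof -
  obtain U w V U' w' V' where c: "c = (U, w, V)" "c' = (U', w', V')" by (metis prod_cases3)
  have cuts: "cut_at D U w V" "cut_at D U' w' V'" "insert w U \<subseteq> U'" using assms c by simp_all
  have dual: "insert w' V' \<subseteq> V" using cut_below_dual assms c by metis
  have "w \<noteq> w'" using cuts unfolding cut_at_def by blast
  then obtain U0 x V0 where x: "cut_at D U0 x V0" "w \<in> U0" "w' \<in> V0"
    using dendron_cut[of w w'] cuts unfolding cut_at_def by metis
  have disj: "U0 \<inter> V0 = {}" "x \<notin> U0" "x \<notin> V0" using x(1) unfolding cut_at_def by blast+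
  have "x \<notin> U"
  proof
    assume "x \<in> U"
    then have "x \<notin> insert w V" using cuts(1) unfolding cut_at_def by blast
    then have "insert w V \<subseteq> U0"
      using cut_one_side[OF x(1) cut_connectedin_both(2)[OF cuts(1)]] x by blast
    then show False using dual x disj by blast
  qed
  then have "x \<notin> insert w U" using x(2) disj by blast
  then have 1: "insert w U \<subseteq> U0"
    using cut_one_side[OF x(1) cut_connectedin_both(1)[OF cuts(1)]] x by blast
  have "x \<notin> V'"
  proof
    assume "x \<in> V'"
    then have "x \<notin> insert w' U'" using cuts(2) unfolding cut_at_def by blast
    then have "insert w' U' \<subseteq> V0"
      using cut_one_side[OF cut_commute[OF x(1)] cut_connectedin_both(1)[OF cuts(2)]] x by blast
    then show False using cuts(3) x disj by blast
  qed
  then have "x \<notin> insert w' V'" using x(3) disj by blast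
  then have "insert w' V' \<subseteq> V0"
    using cut_one_side[OF cut_commute[OF x(1)] cut_connectedin_both(2)[OF cuts(2)]] x by blast
  then have "insert x U0 \<subseteq> U'"
    using cut_complement[OF cuts(2)] cut_complement[OF cut_commute[OF x(1)]] by blast
  then show ?thesis using 1 cuts x c by (intro exI[of _ "(U0, x, V0)"]) simp
qed

text \<open>Cut twice: at \<open>w\<close> between u and v, then at \<open>w'\<close> between
  \<open>w\<close> and v. If \<open>w'\<close> were in \<open>U\<close>, the connected set
  \<open>insert w V\<close> would join \<open>w\<close> to v while avoiding
  \<open>w'\<close>.\<close>

lemma cut_below_exists:
  assumes "u \<in> topspace D" "v \<in> topspace D" "u \<noteq> v"
  obtains U w V U' w' V' where "cut_below D (U, w, V) (U', w', V')" "u \<in> U" "v \<in> V'"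
proof -
  obtain U w V where c: "cut_at D U w V" "u \<in> U" "v \<in> V" using dendron_cut[OF assms] by metis
  have "w \<in> topspace D" "w \<noteq> v" using c unfolding cut_at_def by blast+
  then obtain U' w' V' where c': "cut_at D U' w' V'" "w \<in> U'" "v \<in> V'"
    using dendron_cut[OF _ assms(2)] by metis
  have "w' \<notin> insert w U"
  proof
    assume "w' \<in> insert w U"
    moreover have "w' \<noteq> w" using c' unfolding cut_at_def by blast
    ultimately have "w' \<notin> insert w V" using c(1) unfolding cut_at_def by blast
    then have "insert w V \<subseteq> U'"
      using cut_one_side[OF c'(1) cut_connectedin_both(2)[OF c(1)]] c' by blast
    then show False using c(3) c' unfolding cut_at_def by blast
  qed
  then have "insert w U \<subseteq> U'"
    using cut_one_side[OF c'(1) cut_connectedin_both(1)[OF c(1)]] c' by blast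
  then show thesis using that[of U w V U' w' V'] c c' by simp
qed

end


section \<open>Monotone functions\<close>

text \<open>All clauses are topological, so the class of all these functions is invariant under
  every homeomorphism and serves all groups at once. The cut is demanded only if both levels occur:
  with one of them empty the other could be all of \<open>D\<close>, which is never a side of a
  cut.\<close>

definition monotone_fun :: "'a topology \<Rightarrow> ('a \<Rightarrow> real) \<Rightarrow> bool" where
  "monotone_fun D f \<longleftrightarrow> continuous_map D euclideanreal f \<and> (\<forall>x. x \<notin> topspace D \<longrightarrow> f x = 0) \<and>
     (\<forall>x. 0 \<le> f x \<and> f x \<le> 1) \<and>
     (\<forall>r. connectedin D {x \<in> topspace D. f x < r} \<and> connectedin D {x \<in> topspace D. r < f x}) \<and>
     (\<forall>a b. a < b \<longrightarrow> (\<exists>x\<in>topspace D. f x \<le> a) \<longrightarrow> (\<exists>x\<in>topspace D. b \<le> f x) \<longrightarrow>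
       (\<exists>U w V. cut_at D U w V \<and> {x \<in> topspace D. f x \<le> a} \<subseteq> U \<and> {x \<in> topspace D. b \<le> f x} \<subseteq> V))"

lemma monotone_funD:
  assumes "monotone_fun D f"
  shows "continuous_map D euclideanreal f" "0 \<le> f x" "f x \<le> 1"
    "connectedin D {x \<in> topspace D. f x < r}" "connectedin D {x \<in> topspace D. r < f x}"
  using assms by (simp_all add: monotone_fun_def)

lemma monotone_fun_zero:
  assumes "connected_space D"
  shows "monotone_fun D (\<lambda>_. 0)"
proof -
  have "connectedin D {x \<in> topspace D. P}" for P
    using assms by (cases P) (auto simp: connectedin_topspace)
  then show ?thesis by (auto simp: monotone_fun_def)
qed

text \<open>
  A cut point separating two levels of f lies in every connected set that meets both of these
  levels. If {r < f} crossed {s < g}, then for a suitable s' it would lie in both of {g < s'} and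
  {s' < g}.
\<close>

lemma monotone_fun_noncrossing:
  assumes f: "monotone_fun D f" and g: "monotone_fun D g"
  shows "noncrossing (topspace D) (\<lambda>x. r < f x) (\<lambda>x. s < g x)"
  unfolding noncrossing_def
proof (intro notI, elim bexE conjE)
  fix x y z t
  assume mem: "x \<in> topspace D" "y \<in> topspace D" "z \<in> topspace D" "t \<in> topspace D"
    and levels: "r < f x" "s < g x" "r < f y" "\<not> s < g y" "\<not> r < f z" "s < g z" "\<not> r < f t" "\<not> s < g t"
  define a where "a = max (f z) (f t)"
  define b where "b = min (f x) (f y)"
  have "a < b" "f z \<le> a" "b \<le> f x" using levels by (auto simp: a_def b_def)
  then have "\<exists>U w V. cut_at D U w V \<and> {x \<in> topspace D. f x \<le> a} \<subseteq> U \<and> {x \<in> topspace D. b \<le> f x} \<subseteq> V"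
    using f mem unfolding monotone_fun_def by blast
  then obtain U w V where c: "cut_at D U w V"
    and U: "{x \<in> topspace D. f x \<le> a} \<subseteq> U" and V: "{x \<in> topspace D. b \<le> f x} \<subseteq> V"
    by (elim exE conjE)
  have sides: "z \<in> U" "t \<in> U" "x \<in> V" "y \<in> V"
    using U V mem by (auto simp: a_def b_def subset_iff)
  have disj: "U \<inter> V = {}" using c by (simp add: cut_at_def)
  \<comment> \<open>Raised above \<open>s\<close>, because y and t satisfy only g <= s and have to
    lie in a strict sublevel set.\<close>
  define s' where "s' = (s + min (g x) (g z)) / 2"
  have s': "g y < s'" "g t < s'" "s' < g x" "s' < g z"
    using levels by (auto simp: s'_def min_def)
  have conn: "connectedin D {x \<in> topspace D. g x < s'}" "connectedin D {x \<in> topspace D. s' < g x}"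
    using g unfolding monotone_fun_def by blast+
  have "w \<in> {x \<in> topspace D. g x < s'}"
  proof (rule ccontr)
    assume "w \<notin> {x \<in> topspace D. g x < s'}"
    from cut_one_side[OF c conn(1) this, of t] have "y \<in> U" using sides s' mem by auto
    then show False using sides disj by blast
  qed
  moreover have "w \<in> {x \<in> topspace D. s' < g x}"
  proof (rule ccontr)
    assume "w \<notin> {x \<in> topspace D. s' < g x}"
    from cut_one_side[OF c conn(2) this, of z] have "x \<in> U" using sides s' mem by auto
    then show False using sides disj by blast
  qed
  ultimately show False by simp
qed

lemma monotone_fun_homeomorphism:
  assumes f: "monotone_fun D f"
    and h: "continuous_map D D h" and k: "continuous_map D D k"
    and hk: "\<And>x. x \<in> topspace D \<Longrightarrow> h (k x) = x" and kh: "\<And>x. x \<in> topspace D \<Longrightarrow> k (h x) = x"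
  shows "monotone_fun D (\<lambda>x. if x \<in> topspace D then f (h x) else 0)"
proof -
  define f' where "f' = (\<lambda>x. if x \<in> topspace D then f (h x) else 0)"
  have h_mem: "h x \<in> topspace D" and k_mem: "k x \<in> topspace D" if "x \<in> topspace D" for x
    using h k that by (auto simp: continuous_map_def)
  have "continuous_map D euclideanreal (f \<circ> h)"
    by (rule continuous_map_compose[OF h monotone_funD(1)[OF f]])
  then have cont: "continuous_map D euclideanreal f'"
    by (rule continuous_map_eq) (simp add: f'_def)
  have conn: "connectedin D {x \<in> topspace D. P (f' x)}"
    if "connectedin D {x \<in> topspace D. P (f x)}" for P
  proof -
    have "{x \<in> topspace D. P (f' x)} = k ` {x \<in> topspace D. P (f x)}"
    proof
      show "{x \<in> topspace D. P (f' x)} \<subseteq> k ` {x \<in> topspace D. P (f x)}"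
      proof
        fix x assume "x \<in> {x \<in> topspace D. P (f' x)}"
        then show "x \<in> k ` {x \<in> topspace D. P (f x)}"
          using h_mem kh by (intro image_eqI[of _ _ "h x"]) (auto simp: f'_def)
      qed
    qed (auto simp: f'_def k_mem hk)
    then show ?thesis using connectedin_continuous_map_image[OF k that] by simp
  qed
  have cuts: "\<exists>U w V. cut_at D U w V \<and> {x \<in> topspace D. f' x \<le> a} \<subseteq> U \<and> {x \<in> topspace D. b \<le> f' x} \<subseteq> V"
    if ab: "a < b" "x \<in> topspace D" "f' x \<le> a" "y \<in> topspace D" "b \<le> f' y" for a b x y
  proof -
    have "h x \<in> topspace D" "f (h x) \<le> a" "h y \<in> topspace D" "b \<le> f (h y)"
      using ab h_mem by (auto simp: f'_def)
    then have "\<exists>U w V. cut_at D U w V \<and> {x \<in> topspace D. f x \<le> a} \<subseteq> U \<and> {x \<in> topspace D. b \<le> f x} \<subseteq> V"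
      using f ab(1) unfolding monotone_fun_def by blast
    then obtain U w V where c: "cut_at D U w V"
      and UV: "{x \<in> topspace D. f x \<le> a} \<subseteq> U" "{x \<in> topspace D. b \<le> f x} \<subseteq> V"
      by (elim exE conjE)
    have w: "w \<in> topspace D" "topspace D - {w} = U \<union> V" "U \<inter> V = {}"
      using c by (simp_all add: cut_at_def)
    have eq: "h x = w \<longleftrightarrow> x = k w" if "x \<in> topspace D" for x
      using that hk kh w(1) by metis
    have "cut_at D {x \<in> topspace D. h x \<in> U} (k w) {x \<in> topspace D. h x \<in> V}"
      unfolding cut_at_def
    proof (intro conjI)
      show "openin D {x \<in> topspace D. h x \<in> U}" "openin D {x \<in> topspace D. h x \<in> V}"
        using c by (auto intro: openin_continuous_map_preimage[OF h] simp: cut_at_def)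
      show "topspace D - {k w} = {x \<in> topspace D. h x \<in> U} \<union> {x \<in> topspace D. h x \<in> V}"
      proof (rule Set.set_eqI)
        fix x
        have "h x \<noteq> w \<longleftrightarrow> h x \<in> U \<or> h x \<in> V" if "x \<in> topspace D"
          using h_mem[OF that] w(2) by blast
        then show "x \<in> topspace D - {k w} \<longleftrightarrow>
            x \<in> {x \<in> topspace D. h x \<in> U} \<union> {x \<in> topspace D. h x \<in> V}"
          using eq by auto
      qed
    qed (use w k_mem in auto)
    moreover have "{x \<in> topspace D. f' x \<le> a} \<subseteq> {x \<in> topspace D. h x \<in> U}"
      "{x \<in> topspace D. b \<le> f' x} \<subseteq> {x \<in> topspace D. h x \<in> V}"
      using UV h_mem by (auto simp: f'_def subset_iff)
    ultimately show ?thesis by blast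
  qed
  have "monotone_fun D f'"
    unfolding monotone_fun_def
  proof (intro conjI allI impI)
    show "connectedin D {x \<in> topspace D. f' x < r}" "connectedin D {x \<in> topspace D. r < f' x}" for r
      by (intro conn monotone_funD[OF f])+
    show "0 \<le> f' x" "f' x \<le> 1" for x
      using monotone_funD(2,3)[OF f] by (simp_all add: f'_def)
    show "f' x = 0" if "x \<notin> topspace D" for x
      using that by (simp add: f'_def)
  qed (use cont cuts in blast)+
  then show ?thesis by (simp add: f'_def)
qed

section \<open>Monotone functions separate points\<close>

lemma dyadics_dense:
  fixes a b :: real
  assumes "0 \<le> a" "a < b" "b \<le> 1"
  obtains r where "r \<in> dyadics \<inter> {0..1}" "a < r" "r < b"
proof -
  obtain k where k: "1 / (b - a) < 2 ^ k" using real_arch_pow[of 2] by auto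
  define m where "m = nat \<lfloor>a * 2 ^ k\<rfloor> + 1"
  have "0 \<le> a * 2 ^ k" using assms by simp
  then have m: "a * 2 ^ k < real m" "real m \<le> a * 2 ^ k + 1" unfolding m_def by linarith+
  have "1 < (b - a) * 2 ^ k" using k assms by (simp add: pos_divide_less_eq mult.commute)
  then have "real m < b * 2 ^ k" using m(2) by (simp add: left_diff_distrib)
  then have "a < real m / 2 ^ k" "real m / 2 ^ k < b"
    using m(1) by (simp_all add: pos_less_divide_eq pos_divide_less_eq)
  moreover from this have "0 \<le> real m / 2 ^ k" "real m / 2 ^ k \<le> 1" using assms by linarith+
  moreover have "real m / 2 ^ k \<in> dyadics" unfolding dyadics_def by blast
  ultimately show thesis by (intro that[of "real m / 2 ^ k"] IntI) (simp_all only: atLeastAtMost_iff)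
qed

text \<open>Urysohn's construction along a dyadic scale of cuts between the two points.\<close>

lemma monotone_fun_separates:
  assumes dendron: "dendron D" and uv: "u \<in> topspace D" "v \<in> topspace D" "u \<noteq> v"
  obtains f where "monotone_fun D f" "f u \<noteq> f v"
proof -
  obtain U0 w0 V0 U1 w1 V1 where base: "cut_below D (U0, w0, V0) (U1, w1, V1)" "u \<in> U0" "v \<in> V1"
    using cut_below_exists[OF dendron uv] by metis
  have "\<exists>c :: real \<Rightarrow> 'a set \<times> 'a \<times> 'a set. c 0 = (U0, w0, V0) \<and> c 1 = (U1, w1, V1) \<and>
      (\<forall>p\<in>dyadics \<inter> {0..1}. \<forall>q\<in>dyadics \<inter> {0..1}. p < q \<longrightarrow> cut_below D (c p) (c q))"
    by (rule recursion_on_dyadic_fractions) (fact base(1), erule cut_below_dense[OF dendron],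
        erule cut_below_trans, assumption)
  then obtain c :: "real \<Rightarrow> 'a set \<times> 'a \<times> 'a set"
    where c01: "c 0 = (U0, w0, V0)" "c 1 = (U1, w1, V1)"
      and c: "\<forall>p\<in>dyadics \<inter> {0..1}. \<forall>q\<in>dyadics \<inter> {0..1}. p < q \<longrightarrow> cut_below D (c p) (c q)"
    by (elim exE conjE)
  define I :: "real set" where "I = dyadics \<inter> {0..1}"
  define U where "U r = fst (c r)" for r
  define w where "w r = fst (snd (c r))" for r
  define V where "V r = snd (snd (c r))" for r
  have c_eq: "c r = (U r, w r, V r)" for r by (simp add: U_def w_def V_def)
  have I01: "0 \<in> I" "1 \<in> I"
    using real_in_dyadics[of 0] real_in_dyadics[of 1] by (auto simp: I_def)
  have I_bounds: "0 \<le> r" "r \<le> 1" if "r \<in> I" for r using that by (auto simp: I_def)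
  have below: "cut_below D (U p, w p, V p) (U q, w q, V q)" if "p \<in> I" "q \<in> I" "p < q" for p q
    using c that by (simp add: I_def flip: c_eq)
  have U_mono: "insert (w p) (U p) \<subseteq> U q" and V_mono: "insert (w q) (V q) \<subseteq> V p"
    if "p \<in> I" "q \<in> I" "p < q" for p q
    using below[OF that] cut_below_dual[OF below[OF that]] by simp_all
  have cuts: "cut_at D (U r) (w r) (V r)" if "r \<in> I" for r
  proof (cases "r = 0")
    case True
    then show ?thesis using below[OF I01] by simp
  next
    case False
    then show ?thesis using below[OF I01(1) that] I_bounds[OF that] by simp
  qed
  have dense: "\<exists>r\<in>I. a < r \<and> r < b" if "0 \<le> a" "a < b" "b \<le> 1" for a b
    using dyadics_dense[OF that] unfolding I_def by metis
  have u_mem: "u \<in> U r" if "r \<in> I" for r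
    using U_mono[OF I01(1) that] base(2) c01(1) I_bounds[OF that] c_eq[of 0] by (cases "r = 0") auto
  have v_mem: "v \<in> V r" if "r \<in> I" for r
    using V_mono[OF that I01(2)] base(3) c01(2) I_bounds[OF that] c_eq[of 1] by (cases "r = 1") auto
  \<comment> \<open>The 1 is the value at the points that no \<open>U r\<close> contains.\<close>
  define f where "f x = (if x \<in> topspace D then Inf (insert 1 {r \<in> I. x \<in> U r}) else 0)" for x
  have bdd: "bdd_below (insert 1 {r \<in> I. x \<in> U r})" for x
    using I_bounds by (intro bdd_belowI[of _ 0]) auto
  have f_le: "f x \<le> r" if "x \<in> topspace D" "r \<in> I" "x \<in> U r" for x r
    using that by (auto simp: f_def intro!: cInf_lower bdd)
  have f_le_1: "f x \<le> 1" for x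
    by (auto simp: f_def intro!: cInf_lower bdd)
  have f_nonneg: "0 \<le> f x" for x
    using I_bounds by (auto simp: f_def intro!: cInf_greatest)
  have f_less: "\<exists>p\<in>I. p < r \<and> x \<in> U p" if "x \<in> topspace D" "f x < r" "r \<le> 1" for x r
  proof -
    have "\<exists>p\<in>insert 1 {r \<in> I. x \<in> U r}. p < r"
      using that cInf_less_iff[OF _ bdd[of x]] by (simp add: f_def)
    then show ?thesis using that(3) by auto
  qed
  have f_ge: "r \<le> f x" if x: "x \<in> topspace D" and r: "r \<in> I" "x \<notin> U r" for x r
  proof (rule ccontr)
    assume "\<not> r \<le> f x"
    then have "f x < r" by simp
    from f_less[OF x this I_bounds(2)[OF r(1)]] obtain p where "p \<in> I" "p < r" "x \<in> U p" by blast
    then show False using U_mono[of p r] r by blast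
  qed
  have top: "insert (w r) (U r) \<subseteq> topspace D" "insert (w r) (V r) \<subseteq> topspace D"
    "x \<in> topspace D \<Longrightarrow> x \<notin> U r \<Longrightarrow> x \<in> insert (w r) (V r)"
    "x \<in> insert (w r) (V r) \<Longrightarrow> x \<notin> U r"
    "x \<in> topspace D \<Longrightarrow> x \<notin> insert (w r) (U r) \<Longrightarrow> x \<in> V r" if "r \<in> I" for r x
    using cuts[OF that] unfolding cut_at_def by blast+
  have less_closed: "f x < r"
    if p: "p \<in> I" "p < r" and r: "r \<le> 1" and x: "x \<in> insert (w p) (U p)" for x p r
  proof -
    obtain q where q: "q \<in> I" "p < q" "q < r" using dense[OF I_bounds(1)[OF p(1)] p(2) r] by blast
    then have "x \<in> U q" "x \<in> topspace D" using U_mono[of p q] top(1) p x by blast+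
    then show ?thesis using f_le[of x q] q by simp
  qed
  \<comment> \<open>Each strict level set is described twice: as a union of open sides, for
    continuity, and as a union of sides with the cut point added, which are connected and share the
    point u or v.\<close>
  have less_open_eq: "{x \<in> topspace D. f x < r} = (\<Union>p\<in>{p \<in> I. p < r}. U p)" if "r \<le> 1" for r
    using f_less less_closed top(1) that by fastforce
  have less_eq: "{x \<in> topspace D. f x < r} = (\<Union>p\<in>{p \<in> I. p < r}. insert (w p) (U p))" if "r \<le> 1" for r
    using f_less less_closed top(1) that by fastforce
  have greater_ge: "p \<le> f x" if "p \<in> I" "x \<in> insert (w p) (V p)" for x p
    using f_ge top(2,4) that by blast
  have greater_open: "\<exists>p\<in>I. r < p \<and> x \<in> V p" if x: "x \<in> topspace D" "r < f x" and r: "0 \<le> r" for x r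
  proof -
    obtain q where q: "q \<in> I" "r < q" "q < f x" using dense[OF r x(2) f_le_1] by blast
    obtain p where p: "p \<in> I" "r < p" "p < q" using dense[OF r q(2)] I_bounds[OF q(1)] by blast
    have "x \<notin> U q" using f_le[OF x(1) q(1)] q(3) by auto
    then have "x \<notin> insert (w p) (U p)" using U_mono[OF p(1) q(1) p(3)] by blast
    then show ?thesis using top(5)[OF p(1) x(1)] p by blast
  qed
  have greater_open_eq: "{x \<in> topspace D. r < f x} = (\<Union>p\<in>{p \<in> I. r < p}. V p)" if "0 \<le> r" for r
    using greater_open greater_ge top(2) that by fastforce
  have greater_eq: "{x \<in> topspace D. r < f x} = (\<Union>p\<in>{p \<in> I. r < p}. insert (w p) (V p))" if "0 \<le> r" for r
    using greater_open greater_ge top(2) that by fastforce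
  have all_greater: "{x \<in> topspace D. r < f x} = topspace D" if "\<not> 0 \<le> r" for r
  proof -
    have "r < f x" for x using that f_nonneg[of x] by linarith
    then show ?thesis by simp
  qed
  have all_less: "{x \<in> topspace D. f x < r} = topspace D" if "\<not> r \<le> 1" for r
  proof -
    have "f x < r" for x using that f_le_1[of x] by linarith
    then show ?thesis by simp
  qed
  have conn: "connected_space D" by (rule dendron_connected[OF dendron])
  have connected_UN: "connectedin D (\<Union>p\<in>P. S p)"
    if "\<And>p. p \<in> P \<Longrightarrow> connectedin D (S p)" "\<And>p. p \<in> P \<Longrightarrow> x \<in> S p" for P :: "real set" and S x
  proof (cases "P = {}")
    case False
    have "x \<in> \<Inter> (S ` P)" using that(2) by blast
    then show ?thesis using that(1) by (intro connectedin_Union) blast+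
  qed simp
  have "monotone_fun D f"
    unfolding monotone_fun_def
  proof (intro conjI allI impI)
    show "continuous_map D euclideanreal f"
      unfolding continuous_map_upper_lower_semicontinuous_lt
    proof (intro conjI allI)
      fix r
      show "openin D {x \<in> topspace D. r < f x}"
      proof (cases "0 \<le> r")
        case True
        then show ?thesis using cuts by (auto simp: greater_open_eq cut_at_def)
      next
        case False
        then show ?thesis by (simp add: all_greater)
      qed
      show "openin D {x \<in> topspace D. f x < r}"
      proof (cases "r \<le> 1")
        case True
        then show ?thesis using cuts by (auto simp: less_open_eq cut_at_def)
      next
        case False
        then show ?thesis by (simp add: all_less)
      qed
    qed
    fix r
    show "connectedin D {x \<in> topspace D. r < f x}"
    proof (cases "0 \<le> r")
      case True
      show ?thesis
        unfolding greater_eq[OF True]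
        by (rule connected_UN[of _ _ v]) (use cut_connectedin_both(2)[OF dendron cuts] v_mem in auto)
    next
      case False
      then show ?thesis using conn by (simp add: all_greater connectedin_topspace)
    qed
    show "connectedin D {x \<in> topspace D. f x < r}"
    proof (cases "r \<le> 1")
      case True
      show ?thesis
        unfolding less_eq[OF True]
        by (rule connected_UN[of _ _ u]) (use cut_connectedin_both(1)[OF dendron cuts] u_mem in auto)
    next
      case False
      then show ?thesis using conn by (simp add: all_less connectedin_topspace)
    qed
  next
    fix a b :: real assume ab: "a < b" and "\<exists>x\<in>topspace D. f x \<le> a" "\<exists>x\<in>topspace D. b \<le> f x"
    then have "0 \<le> a" "b \<le> 1" using f_nonneg f_le_1 by (auto intro: order_trans)
    \<comment> \<open>The cut at a dyadic strictly between the two levels separates them.\<close>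
    then obtain p where p: "p \<in> I" "a < p" "p < b" using dense ab by blast
    have "x \<in> U p" if "x \<in> topspace D" "f x \<le> a" for x
      using f_ge[OF that(1) p(1)] that(2) p(2) by force
    moreover have "x \<in> V p" if "x \<in> topspace D" "b \<le> f x" for x
    proof (rule top(5)[OF p(1) that(1)])
      show "x \<notin> insert (w p) (U p)"
        using less_closed[OF p(1,3) \<open>b \<le> 1\<close>, of x] that by auto
    qed
    ultimately show "\<exists>U w V. cut_at D U w V \<and> {x \<in> topspace D. f x \<le> a} \<subseteq> U \<and>
        {x \<in> topspace D. b \<le> f x} \<subseteq> V"
      using cuts[OF p(1)] by blast
  qed (auto simp: f_le_1 f_nonneg, simp add: f_def)
  moreover have "f u < f v"
    using f_le[OF uv(1) I01(1) u_mem[OF I01(1)]] greater_ge[OF I01(2), of v] v_mem[OF I01(2)] by auto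
  ultimately show thesis using that[of f] by simp
qed

lemma dendron_noncrossing_system:
  assumes dendron: "dendron D" and G: "topological_group G T" and act: "continuous_action G T D \<phi>"
  shows "noncrossing_system D {f. monotone_fun D f} G T \<phi>"
proof
  show "compact_space D" "Hausdorff_space D"
    using dendron by (simp_all add: dendron_def continuum_def)
  show "{f. monotone_fun D f} \<noteq> {}"
    using monotone_fun_zero[OF dendron_connected[OF dendron]] by blast
  show "\<exists>f\<in>{f. monotone_fun D f}. f x \<noteq> f y"
    if "x \<in> topspace D" "y \<in> topspace D" "x \<noteq> y" for x y
    using monotone_fun_separates[OF dendron that] by blast
  show "topological_group G T" "continuous_action G T D \<phi>" by fact+
  show "noncrossing (topspace D) (\<lambda>x. r < f x) (\<lambda>x. s < g x)"
    if "f \<in> {f. monotone_fun D f}" "g \<in> {f. monotone_fun D f}" for f g r s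
    using that by (intro monotone_fun_noncrossing) auto
next
  fix f g assume f: "f \<in> {f. monotone_fun D f}" and g: "g \<in> carrier G"
  interpret group G using G by (simp add: topological_group_def)
  interpret group_action G "topspace D" \<phi> using act by (simp add: continuous_action_def)
  have "monotone_fun D (\<lambda>x. if x \<in> topspace D then f (\<phi> g x) else 0)"
  proof (rule monotone_fun_homeomorphism)
    show "\<phi> g (\<phi> (inv\<^bsub>G\<^esub> g) x) = x" if "x \<in> topspace D" for x
      using orbit_sym_aux[of "inv\<^bsub>G\<^esub> g" x] g that by simp
    show "\<phi> (inv\<^bsub>G\<^esub> g) (\<phi> g x) = x" if "x \<in> topspace D" for x
      using orbit_sym_aux[of g x] g that by simp
  qed (use f g continuous_action_slice[OF G act] in auto)
  then show "(\<lambda>x. if x \<in> topspace D then f (\<phi> g x) else 0) \<in> {f. monotone_fun D f}" by simp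
qed (auto simp: monotone_fun_def)

theorem theorem1p3:
  fixes D :: "'a topology"
    and G :: "('g, 'm) monoid_scheme"
    and T :: "'g topology"
    and \<phi> :: "'g \<Rightarrow> 'a \<Rightarrow> 'a"
  assumes "dendron D"
    and "topological_group G T"
    and "continuous_action G T D \<phi>"
  shows "Rosenthal_representable G T D \<phi> \<and> tame_system G D \<phi>"
proof -
  interpret noncrossing_system D "{f. monotone_fun D f}" G T \<phi>
    using assms by (rule dendron_noncrossing_system)
  show ?thesis
    unfolding Rosenthal_representable_def
    using interp_Rosenthal_space evaluation_representation evaluation_embedding tame by blast
qed

end
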